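(* Let $q$ be a power of an odd prime $p$, let $\tau\in\mathbb{F}_q^{*}$ with $\tau\neq 1$, and let $c_0\in\mathbb{F}_q^{*}$ be a non-square. Let $\mathrm{WP}\subset (A\cup B_\tau)^{*}$ be the word problem of the group $\Gamma_\tau$ with respect to the generating set $A\cup B_\tau$. Let $a,c\in A$ and $b,d\in B_\tau$ be such that $abcd=e$ in $\Gamma_\tau$ and $a,b$ do not commute. Then $$P(\mathrm{WP}\cap a^*b^*c^*d^* )=\{(0,0,0,0)\}\cup\{(p^{k_\tau n},p^{k_\tau n},p^{k_\tau n},p^{k_\tau n}) : n\geq 0\},$$ where $P(\mathrm{WP}\cap a^*b^*c^*d^* )=\{(n_1,n_2,n_3,n_4)\in\mathbb{N}_0^4 : a^{n_1}b^{n_2}c^{n_3}d^{n_4}\in\mathrm{WP}\}$.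
   Context: $\mathbb{N}_0$ is the set of non-negative integers. The word problem of a group $G$ with respect to a finite symmetric generating set $S$ is $\mathrm{WP}(G,S)=\{w\in S^{*} : w=_G e\}$. The groups $\Gamma_\tau$: let $K=\mathbb{F}_q(t)$ be the rational function field, and let $D$ be the quaternion algebra over $K$ with $K$-basis $1,Z,F,ZF$ and multiplication $Z^2=c_0$, $F^2=t(t-1)$, $ZF=-FZ$. The subset $\mathbb{F}_q[Z]\subset D$ is a field with $q^2$ elements, with norm $N(\xi)=\xi\overline{\xi}=\xi^{q+1}\in\mathbb{F}_q$, where $\overline{\xi}=\xi^q$. Put $N_{c_0}=\{\xi\in\mathbb{F}_q[Z]^{*} : N(\xi)=-c_0\}$ and $M_\tau=\{\eta\in\mathbb{F}_q[Z]^{*} : N(\eta)=\frac{c_0\tau}{1-\tau}\}$. Then $\Gamma_\tau$ is the subgroup of $D^{*}/K^{*}$ generated by $A\cup B_\tau$, where $A$ is the set of classes of the elements $a_\xi:=c_0t+\xi FZ$, $\xi\in N_{c_0}$, and $B_\tau$ is the set of classes of the elements $b_\eta:=c_0t+\eta FZ$, $\eta\in M_\tau$. (The sets $A$ and $B_\tau$ are disjoint and closed under inverses.) The number $k_\tau$ is the smallest positive integer $k$ such that $\left(\frac{\tau}{\tau-1}\right)^{\frac{p^k-1}{2}}=1$ in $\mathbb{F}_q$. *)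

theory Defs
  imports
    "HOL-Library.Cardinality"
    "HOL-Computational_Algebra.Polynomial_Factorial"
    "HOL-Algebra.Generated_Groups"
    "HOL-Algebra.Ring"
begin

section \<open>Words and the word problem\<close>

definition word_value :: "('g, 'm) monoid_scheme \<Rightarrow> 'g list \<Rightarrow> 'g" where
  "word_value G w = foldr (\<lambda>x y. x \<otimes>\<^bsub>G\<^esub> y) w \<one>\<^bsub>G\<^esub>"

text \<open>The alphabet \<open>S\<close> is meant to be a finite symmetric generating set of \<open>G\<close>.\<close>

definition word_problem :: "('g, 'm) monoid_scheme \<Rightarrow> 'g set \<Rightarrow> 'g list set" where
  "word_problem G S = {w \<in> lists S. word_value G w = \<one>\<^bsub>G\<^esub>}"


section \<open>Quaternion algebras\<close>

text \<open>\<open>Quat x\<^sub>0 x\<^sub>1 x\<^sub>2 x\<^sub>3\<close> stands for \<open>x\<^sub>0 + x\<^sub>1 Z + x\<^sub>2 F + x\<^sub>3 ZF\<close>.\<close>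

datatype 'k quat = Quat 'k 'k 'k 'k

text \<open>
  The quaternion algebra over \<open>'k\<close> with \<open>Z\<^sup>2 = \<alpha>\<close>, \<open>F\<^sup>2 = \<beta>\<close>, \<open>ZF = -FZ\<close>; the lemmas below show
  that the product formula is the one determined by these relations.
\<close>

fun quat_add :: "'k::field quat \<Rightarrow> 'k quat \<Rightarrow> 'k quat" where
  "quat_add (Quat x0 x1 x2 x3) (Quat y0 y1 y2 y3) =
     Quat (x0 + y0) (x1 + y1) (x2 + y2) (x3 + y3)"

fun quat_mult :: "'k::field \<Rightarrow> 'k \<Rightarrow> 'k quat \<Rightarrow> 'k quat \<Rightarrow> 'k quat" where
  "quat_mult \<alpha> \<beta> (Quat x0 x1 x2 x3) (Quat y0 y1 y2 y3) = Quat
     (x0 * y0 + \<alpha> * x1 * y1 + \<beta> * x2 * y2 - \<alpha> * \<beta> * x3 * y3)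
     (x0 * y1 + x1 * y0 - \<beta> * x2 * y3 + \<beta> * x3 * y2)
     (x0 * y2 + x2 * y0 + \<alpha> * x1 * y3 - \<alpha> * x3 * y1)
     (x0 * y3 + x3 * y0 + x1 * y2 - x2 * y1)"

definition scalar :: "'k::field \<Rightarrow> 'k quat" where
  "scalar x = Quat x 0 0 0"

definition quat_Z :: "'k::field quat" where
  "quat_Z = Quat 0 1 0 0"

definition quat_F :: "'k::field quat" where
  "quat_F = Quat 0 0 1 0"

definition quaternion_algebra :: "'k::field \<Rightarrow> 'k \<Rightarrow> 'k quat ring" where
  "quaternion_algebra \<alpha> \<beta> =
     \<lparr>carrier = UNIV, mult = quat_mult \<alpha> \<beta>, one = scalar 1, zero = scalar 0, add = quat_add\<rparr>"

lemma ring_quaternion_algebra: "ring (quaternion_algebra \<alpha> \<beta>)"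
proof (rule ringI)
  show "abelian_group (quaternion_algebra \<alpha> \<beta>)"
  proof (rule abelian_groupI)
    fix x assume "x \<in> carrier (quaternion_algebra \<alpha> \<beta>)"
    obtain x0 x1 x2 x3 where "x = Quat x0 x1 x2 x3" by (cases x)
    then show "\<exists>y\<in>carrier (quaternion_algebra \<alpha> \<beta>).
        y \<oplus>\<^bsub>quaternion_algebra \<alpha> \<beta>\<^esub> x = \<zero>\<^bsub>quaternion_algebra \<alpha> \<beta>\<^esub>"
      by (intro bexI[of _ "Quat (-x0) (-x1) (-x2) (-x3)"])
         (auto simp: quaternion_algebra_def scalar_def)
  next
    fix x y z :: "'a quat"
    show "x \<oplus>\<^bsub>quaternion_algebra \<alpha> \<beta>\<^esub> y \<oplus>\<^bsub>quaternion_algebra \<alpha> \<beta>\<^esub> z =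
        x \<oplus>\<^bsub>quaternion_algebra \<alpha> \<beta>\<^esub> (y \<oplus>\<^bsub>quaternion_algebra \<alpha> \<beta>\<^esub> z)"
      by (cases x; cases y; cases z) (simp add: quaternion_algebra_def algebra_simps)
  next
    fix x y :: "'a quat"
    show "x \<oplus>\<^bsub>quaternion_algebra \<alpha> \<beta>\<^esub> y = y \<oplus>\<^bsub>quaternion_algebra \<alpha> \<beta>\<^esub> x"
      by (cases x; cases y) (simp add: quaternion_algebra_def algebra_simps)
  next
    fix x :: "'a quat"
    show "\<zero>\<^bsub>quaternion_algebra \<alpha> \<beta>\<^esub> \<oplus>\<^bsub>quaternion_algebra \<alpha> \<beta>\<^esub> x = x"
      by (cases x) (simp add: quaternion_algebra_def scalar_def)
  qed (auto simp: quaternion_algebra_def)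
next
  show "monoid (quaternion_algebra \<alpha> \<beta>)"
  proof
    fix x y z :: "'a quat"
    show "x \<otimes>\<^bsub>quaternion_algebra \<alpha> \<beta>\<^esub> y \<otimes>\<^bsub>quaternion_algebra \<alpha> \<beta>\<^esub> z =
        x \<otimes>\<^bsub>quaternion_algebra \<alpha> \<beta>\<^esub> (y \<otimes>\<^bsub>quaternion_algebra \<alpha> \<beta>\<^esub> z)"
      by (cases x; cases y; cases z) (simp add: quaternion_algebra_def algebra_simps)
  next
    fix x :: "'a quat"
    show "\<one>\<^bsub>quaternion_algebra \<alpha> \<beta>\<^esub> \<otimes>\<^bsub>quaternion_algebra \<alpha> \<beta>\<^esub> x = x"
      by (cases x) (simp add: quaternion_algebra_def scalar_def)
    show "x \<otimes>\<^bsub>quaternion_algebra \<alpha> \<beta>\<^esub> \<one>\<^bsub>quaternion_algebra \<alpha> \<beta>\<^esub> = x"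
      by (cases x) (simp add: quaternion_algebra_def scalar_def)
  qed (auto simp: quaternion_algebra_def)
next
  fix x y z :: "'a quat"
  show "(x \<oplus>\<^bsub>quaternion_algebra \<alpha> \<beta>\<^esub> y) \<otimes>\<^bsub>quaternion_algebra \<alpha> \<beta>\<^esub> z =
      x \<otimes>\<^bsub>quaternion_algebra \<alpha> \<beta>\<^esub> z \<oplus>\<^bsub>quaternion_algebra \<alpha> \<beta>\<^esub> y \<otimes>\<^bsub>quaternion_algebra \<alpha> \<beta>\<^esub> z"
    by (cases x; cases y; cases z) (simp add: quaternion_algebra_def algebra_simps)
  show "z \<otimes>\<^bsub>quaternion_algebra \<alpha> \<beta>\<^esub> (x \<oplus>\<^bsub>quaternion_algebra \<alpha> \<beta>\<^esub> y) =
      z \<otimes>\<^bsub>quaternion_algebra \<alpha> \<beta>\<^esub> x \<oplus>\<^bsub>quaternion_algebra \<alpha> \<beta>\<^esub> z \<otimes>\<^bsub>quaternion_algebra \<alpha> \<beta>\<^esub> y"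
    by (cases x; cases y; cases z) (simp add: quaternion_algebra_def algebra_simps)
qed

lemma quaternion_algebra_relations:
  fixes \<alpha> \<beta> x :: "'k::field"
  defines "R \<equiv> quaternion_algebra \<alpha> \<beta>"
  shows "quat_Z \<otimes>\<^bsub>R\<^esub> quat_Z = scalar \<alpha>"
    and "quat_F \<otimes>\<^bsub>R\<^esub> quat_F = scalar \<beta>"
    and "quat_Z \<otimes>\<^bsub>R\<^esub> quat_F = scalar (-1) \<otimes>\<^bsub>R\<^esub> (quat_F \<otimes>\<^bsub>R\<^esub> quat_Z)"
    and "scalar x \<otimes>\<^bsub>R\<^esub> u = u \<otimes>\<^bsub>R\<^esub> scalar x"
    and "Quat x0 x1 x2 x3 = scalar x0 \<oplus>\<^bsub>R\<^esub> scalar x1 \<otimes>\<^bsub>R\<^esub> quat_Z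
           \<oplus>\<^bsub>R\<^esub> scalar x2 \<otimes>\<^bsub>R\<^esub> quat_F \<oplus>\<^bsub>R\<^esub> scalar x3 \<otimes>\<^bsub>R\<^esub> (quat_Z \<otimes>\<^bsub>R\<^esub> quat_F)"
  by (cases u; simp add: R_def quaternion_algebra_def scalar_def quat_Z_def quat_F_def)+


section \<open>The groups \<open>\<Gamma>\<^sub>\<tau>\<close>\<close>

text \<open>\<open>\<F>\<^sub>q\<close> is the finite field \<open>'a\<close>, and \<open>K = \<F>\<^sub>q(t)\<close> is \<open>'a poly fract\<close>.\<close>

definition const_K :: "'a::finite_field \<Rightarrow> 'a poly fract" where
  "const_K x = to_fract [:x:]"

definition t_K :: "'a::finite_field poly fract" where
  "t_K = to_fract [:0, 1:]"

definition quat_D :: "'a::finite_field \<Rightarrow> 'a poly fract quat ring" where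
  "quat_D c0 = quaternion_algebra (const_K c0) (t_K * (t_K - 1))"

text \<open>Since \<open>Z\<^sup>2 = c\<^sub>0\<close>, the subring \<open>\<F>\<^sub>q[Z]\<close> consists of the elements \<open>x + y Z\<close> with \<open>x, y \<in> \<F>\<^sub>q\<close>.\<close>

definition Fq_Z :: "'a::finite_field \<Rightarrow> 'a poly fract quat set" where
  "Fq_Z c0 = {scalar (const_K x) \<oplus>\<^bsub>quat_D c0\<^esub> scalar (const_K y) \<otimes>\<^bsub>quat_D c0\<^esub> quat_Z | x y. True}"

text \<open>On \<open>\<F>\<^sub>q[Z]\<close>, conjugation is the Frobenius map \<open>\<xi> \<mapsto> \<xi>\<^sup>q\<close>; it is only applied there.\<close>

definition quat_conj :: "'a::finite_field \<Rightarrow> 'a poly fract quat \<Rightarrow> 'a poly fract quat" where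
  "quat_conj c0 \<xi> = \<xi> [^]\<^bsub>quat_D c0\<^esub> CARD('a)"

text \<open>The elements of \<open>\<F>\<^sub>q[Z]\<^sup>*\<close> of norm \<open>r \<in> \<F>\<^sub>q\<close>.\<close>

definition norm_fibre :: "'a::finite_field \<Rightarrow> 'a \<Rightarrow> 'a poly fract quat set" where
  "norm_fibre c0 r =
     {\<xi> \<in> Fq_Z c0 - {\<zero>\<^bsub>quat_D c0\<^esub>}. \<xi> \<otimes>\<^bsub>quat_D c0\<^esub> quat_conj c0 \<xi> = scalar (const_K r)}"

definition K_units :: "'a::finite_field poly fract quat set" where
  "K_units = scalar ` (UNIV - {0})"

definition proj_units :: "'a::finite_field \<Rightarrow> 'a poly fract quat set monoid" where
  "proj_units c0 = units_of (quat_D c0) Mod K_units"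

definition proj_class :: "'a::finite_field \<Rightarrow> 'a poly fract quat \<Rightarrow> 'a poly fract quat set" where
  "proj_class c0 x = K_units #>\<^bsub>units_of (quat_D c0)\<^esub> x"

text \<open>The class of \<open>c\<^sub>0 t + \<xi> F Z\<close>.\<close>

definition gen_class :: "'a::finite_field \<Rightarrow> 'a poly fract quat \<Rightarrow> 'a poly fract quat set" where
  "gen_class c0 \<xi> =
     proj_class c0 (scalar (const_K c0 * t_K) \<oplus>\<^bsub>quat_D c0\<^esub> \<xi> \<otimes>\<^bsub>quat_D c0\<^esub> quat_F \<otimes>\<^bsub>quat_D c0\<^esub> quat_Z)"

definition gens_A :: "'a::finite_field \<Rightarrow> 'a poly fract quat set set" where
  "gens_A c0 = gen_class c0 ` norm_fibre c0 (- c0)"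

definition gens_B :: "'a::finite_field \<Rightarrow> 'a \<Rightarrow> 'a poly fract quat set set" where
  "gens_B c0 \<tau> = gen_class c0 ` norm_fibre c0 (c0 * \<tau> / (1 - \<tau>))"

definition Gamma :: "'a::finite_field \<Rightarrow> 'a \<Rightarrow> 'a poly fract quat set monoid" where
  "Gamma c0 \<tau> =
     (proj_units c0)\<lparr>carrier := generate (proj_units c0) (gens_A c0 \<union> gens_B c0 \<tau>)\<rparr>"

definition k_exp :: "nat \<Rightarrow> 'a::finite_field \<Rightarrow> nat" where
  "k_exp p \<tau> = (LEAST k. 0 < k \<and> (\<tau> / (\<tau> - 1)) ^ ((p ^ k - 1) div 2) = 1)"

lemma K_units_normal: "K_units \<lhd> units_of (quat_D c0)"
proof -
  interpret R: ring "quat_D c0"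
    unfolding quat_D_def by (rule ring_quaternion_algebra)
  interpret U: group "units_of (quat_D c0)"
    by (rule R.units_group)
  have mult: "scalar x \<otimes>\<^bsub>quat_D c0\<^esub> scalar y = scalar (x * y)" for x y
    by (simp add: quat_D_def quaternion_algebra_def scalar_def)
  have one: "\<one>\<^bsub>quat_D c0\<^esub> = scalar 1"
    by (simp add: quat_D_def quaternion_algebra_def)
  have UNIV: "carrier (quat_D c0) = UNIV"
    by (simp add: quat_D_def quaternion_algebra_def)
  have unit: "scalar x \<in> Units (quat_D c0)" if "x \<noteq> 0" for x
    unfolding Units_def using that
    by (auto simp: UNIV mult one intro!: exI[of _ "scalar (inverse x)"])
  have inv: "inv\<^bsub>units_of (quat_D c0)\<^esub> scalar x = scalar (inverse x)" if "x \<noteq> 0" for x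
    by (rule U.inv_equality)
       (use that unit in \<open>auto simp: units_of_carrier units_of_mult units_of_one mult one\<close>)
  have central: "scalar x \<otimes>\<^bsub>quat_D c0\<^esub> u = u \<otimes>\<^bsub>quat_D c0\<^esub> scalar x" for x u
    unfolding quat_D_def by (rule quaternion_algebra_relations(4))
  have "subgroup K_units (units_of (quat_D c0))"
  proof (rule U.subgroupI)
    show "K_units \<subseteq> carrier (units_of (quat_D c0))"
      by (auto simp: K_units_def units_of_carrier intro: unit)
    show "K_units \<noteq> ({} :: 'a poly fract quat set)"
      unfolding K_units_def by (metis empty_iff image_eqI insert_iff DiffI UNIV_I zero_neq_one)
  qed (auto simp: K_units_def units_of_mult inv mult)
  then show ?thesis
    unfolding normal_def normal_axioms_def
    by (auto simp: U.is_group r_coset_def l_coset_def units_of_mult K_units_def central)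
qed

lemma group_proj_units: "group (proj_units c0)"
  unfolding proj_units_def by (rule normal.factorgroup_is_group[OF K_units_normal])

end

theory Submission
  imports Defs
begin

text \<open>
  Put $h = (t-1)/t$, which is transcendental over $\mathbb{F}_q$. Dividing the representative of a
  generator by $c_0 t$ turns it into $1 + X$ with $X = (u + vZ) F / t$, and
  $X^2 = \nu h$ for the constant $\nu = u^2 - c_0 v^2$, which is $1$ for the generators in $A$ and
  $\rho = \tau / (\tau - 1) \neq 1$ for those in $B_\tau$. The four letters thus become $1 + X$,
  $1 + Y$, $1 + X'$, $1 + Y'$ in the quaternion algebra $(c_0, h)$ over $\mathbb{F}_q[h]$.
  
  \<^emph>\<open>Equal exponents.\<close> The power $(1 + X)^n$ is $f + g X$, where $f$ and $g$ are the even and the odd part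
  of $(1 + \sqrt{\nu h})^n$; its norm is $f^2 - \nu h g^2 = (1 - \nu h)^n$. The relation
  $a^m b^n c^{m'} d^{n'} = e$ says that $(1 + X)^m (1 + Y)^n$ and $(1 - Y')^{n'} (1 - X')^{m'}$
  agree up to a factor from $K^*$. Neither side is divisible by one of the primes $1 - h$ and
  $1 - \rho h$ that occur in its norm, so comparing norms forces $m = m'$, $n = n'$ and equality
  of the two sides (\<open>unit_class_products_eq_iff\<close>).
  
  \<^emph>\<open>Reduction to one variable.\<close> Subtracting what the relation $abcd = e$ gives for the coefficients, the only
  remaining condition is $g_m \tilde f_n = f_m \tilde g_n$, multiplied by each of the two coordinates of
  $X + X'$; here $f_m, g_m$ belong to $\nu = 1$ and $\tilde f_n, \tilde g_n$ to $\nu = \rho$. If $X'$ were $-X$, then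
  $Y'$ would be $-Y$ and the relation would read $ab = ba$, so the factor $X + X'$ may be cancelled. As even and odd parts are
  coprime and normalised, the condition is that $(1 + \sqrt h)^m$ and $(1 + \sqrt{\rho h})^n$ have the same even
  part and, up to the square roots, the same odd part.
  
  \<^emph>\<open>Powers of $p$.\<close> If $p$ divides the exponents, both sides are $p$-th powers and one can descend. If not, then
  the Wronskian of the norms $(1 - h)^m$ and $(1 - \rho h)^n$ is, apart from powers of $1 - h$ and
  $1 - \rho h$, a nonzero polynomial of degree at most $1$ which $f g$ divides; since $f g$ has degree
  at least $m - 1$ and $n - 1$, this leaves only $m = n = 1$ (\<open>parts_eq_imp_trivial_exponents\<close>). Hence $m = n = p^i$, where
  $(1 + X)^{p^i} = 1 + h^{(p^i-1)/2} X$ and $(1 + Y)^{p^i} = 1 + (\rho h)^{(p^i-1)/2} Y$, so the condition becomes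
  $\rho^{(p^i-1)/2} = 1$. The exponents $i$ with this property are the multiples of $k_\tau$.
\<close>

section \<open>Even and odd parts of powers of a binomial\<close>

text \<open>
  The polynomials $f$, $g$ in $h$ with $(1 + s)^n = f + g s$ whenever $s^2 = \alpha h$. The recursion
  is multiplication by $1 + s$, so no square root of $\alpha h$ has to exist.
\<close>

fun even_part odd_part :: "'a::comm_ring_1 \<Rightarrow> nat \<Rightarrow> 'a poly" where
  "even_part \<alpha> 0 = 1"
| "even_part \<alpha> (Suc n) = even_part \<alpha> n + [:0, \<alpha>:] * odd_part \<alpha> n"
| "odd_part \<alpha> 0 = 0"
| "odd_part \<alpha> (Suc n) = even_part \<alpha> n + odd_part \<alpha> n"

text \<open>
  This is $(1 + s)^n (1 - s)^n = (1 - s^2)^n$.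
\<close>

lemma norm_parts:
  "even_part \<alpha> n ^ 2 - [:0, \<alpha>:] * odd_part \<alpha> n ^ 2 = [:1, -\<alpha>:] ^ n"
proof (induction n)
  case (Suc n)
  have one: "[:1, -\<alpha>:] = 1 - [:0, \<alpha>:]" by (simp add: one_pCons)
  have "even_part \<alpha> (Suc n) ^ 2 - [:0, \<alpha>:] * odd_part \<alpha> (Suc n) ^ 2
      = (1 - [:0, \<alpha>:]) * (even_part \<alpha> n ^ 2 - [:0, \<alpha>:] * odd_part \<alpha> n ^ 2)"
    unfolding even_part.simps odd_part.simps
    by (simp add: power2_eq_square algebra_simps del: mult_pCons_left mult_pCons_right)
  then show ?case by (simp only: Suc one power_Suc)
qed simp

lemma parts_add:
  "even_part \<alpha> (m + n) = even_part \<alpha> m * even_part \<alpha> n + [:0, \<alpha>:] * odd_part \<alpha> m * odd_part \<alpha> n"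
  "odd_part \<alpha> (m + n) = even_part \<alpha> m * odd_part \<alpha> n + odd_part \<alpha> m * even_part \<alpha> n"
  by (induction m) (simp_all add: algebra_simps del: mult_pCons_left mult_pCons_right)

lemma coeff_parts:
  "coeff (even_part \<alpha> n) i = of_nat (n choose (2 * i)) * \<alpha> ^ i"
  "coeff (odd_part \<alpha> n) i = of_nat (n choose (2 * i + 1)) * \<alpha> ^ i"
proof (induction n arbitrary: i)
  case 0
  { case 1 show ?case by (cases i) auto next case 2 show ?case by simp }
next
  case (Suc n)
  { case 1 show ?case by (cases i) (simp_all add: Suc algebra_simps)
  next case 2 show ?case by (simp add: Suc algebra_simps) }
qed

text \<open>
  Where $\alpha h = 1$, one may take $s = 1$ and $s = -1$: then $f + g = 2^n$ and $f - g = 0$.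
\<close>

lemma parts_at_root:
  assumes "\<alpha> * z = 1" "n \<ge> 1"
  shows "poly (even_part \<alpha> n) z = 2 ^ (n - 1)" "poly (odd_part \<alpha> n) z = 2 ^ (n - 1)"
  using assms(2)
proof (induction n rule: nat_induct_at_least)
  case (Suc n)
  have "(2::'a) ^ n = 2 ^ (n - 1) + \<alpha> * z * 2 ^ (n - 1)"
    using Suc(1) by (simp add: assms(1) flip: mult_2 power_Suc)
  then show "poly (even_part \<alpha> (Suc n)) z = 2 ^ (Suc n - 1)"
    by (simp add: Suc mult_ac)
  show "poly (odd_part \<alpha> (Suc n)) z = 2 ^ (Suc n - 1)"
    using Suc(1) by (simp add: Suc flip: mult_2 power_Suc)
qed (use assms(1) in simp_all)

lemma two_nonzero_of_odd_char:
  assumes "odd CHAR('a::{comm_ring_1,semiring_prime_char})"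
  shows "(2::'a) \<noteq> 0"
proof
  assume "(2::'a) = 0"
  then have "CHAR('a) dvd 2" using of_nat_eq_0_iff_char_dvd[of 2, where 'a = 'a] by simp
  then show False using assms primes_dvd_imp_eq[OF CHAR_prime[where 'a = 'a] two_is_prime_nat] by simp
qed

text \<open>
  In characteristic $p$ only the extreme binomial coefficients survive in $(1 + s)^p$, so that it
  equals $1 + s^p$, and $s^p = (\alpha h)^{(p-1)/2} s$.
\<close>

lemma parts_char:
  fixes \<alpha> :: "'a::{comm_ring_1,semiring_prime_char}"
  assumes p: "p = CHAR('a)" "odd p"
  shows "even_part \<alpha> p = 1" "odd_part \<alpha> p = [:0, \<alpha>:] ^ ((p - 1) div 2)"
proof -
  have pr: "prime p" using p by simp
  have z: "of_nat (p choose k) = (0::'a)" if "k \<noteq> 0" "k \<noteq> p" for k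
  proof (cases "k < p")
    case True
    then show ?thesis using pr p that by (simp add: of_nat_eq_0_iff_char_dvd dvd_choose_prime)
  qed (use that in \<open>simp add: binomial_eq_0\<close>)
  have o: "2 * i + 1 = p \<longleftrightarrow> i = (p - 1) div 2" for i using p(2) by (auto elim!: oddE)
  have mon: "[:0, \<alpha>:] ^ k = monom (\<alpha> ^ k) k" for k
    by (simp add: monom_altdef flip: smult_power) 
  show "even_part \<alpha> p = 1"
  proof (rule poly_eqI)
    fix i show "coeff (even_part \<alpha> p) i = coeff 1 i"
      using z[of "2 * i"] p(2) by (cases "i = 0"; cases "2 * i = p") (auto simp: coeff_parts)
  qed
  show "odd_part \<alpha> p = [:0, \<alpha>:] ^ ((p - 1) div 2)"
  proof (rule poly_eqI)
    fix i show "coeff (odd_part \<alpha> p) i = coeff ([:0, \<alpha>:] ^ ((p - 1) div 2)) i"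
      using z[of "2 * i + 1"] o[of i] by (auto simp: coeff_parts mon)
  qed
qed

text \<open>
  Here $(1 + s)^{pn} = (1 + s^p)^n$, and $s^p$ is a square root of $\alpha^p h^p$.
\<close>

lemma parts_char_mult:
  fixes \<alpha> :: "'a::{comm_ring_1,semiring_prime_char}"
  assumes p: "p = CHAR('a)" "odd p"
  shows "even_part \<alpha> (p * n) = pcompose (even_part (\<alpha> ^ p) n) (monom 1 p)"
    "odd_part \<alpha> (p * n) = [:0, \<alpha>:] ^ ((p - 1) div 2) * pcompose (odd_part (\<alpha> ^ p) n) (monom 1 p)"
proof (induction n)
  case (Suc n)
  let ?e = "(p - 1) div 2"
  have "p = Suc (?e + ?e)" using p(2) by (auto elim!: oddE)
  then have "[:0, \<alpha>:] ^ p = [:0, \<alpha>:] ^ Suc (?e + ?e)" by (rule arg_cong)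
  then have "[:0, \<alpha>:] * [:0, \<alpha>:] ^ ?e * [:0, \<alpha>:] ^ ?e = [:0, \<alpha>:] ^ p"
    by (simp only: power_add power_Suc mult.assoc)
  also have "\<dots> = [:0, \<alpha> ^ p:] \<circ>\<^sub>p monom 1 p"
    by (simp add: pcompose_pCons smult_monom monom_altdef flip: smult_power)
  finally have e: "[:0, \<alpha>:] * [:0, \<alpha>:] ^ ?e * [:0, \<alpha>:] ^ ?e = [:0, \<alpha> ^ p:] \<circ>\<^sub>p monom 1 p" .
  have "even_part \<alpha> (p * Suc n) = even_part \<alpha> (p * n) + [:0, \<alpha>:] * [:0, \<alpha>:] ^ ?e * odd_part \<alpha> (p * n)"
    using parts_add(1)[of \<alpha> p "p * n"] by (simp only: mult_Suc_right parts_char[OF p] mult_1_left)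
  also have "\<dots> = even_part (\<alpha> ^ p) n \<circ>\<^sub>p monom 1 p
      + [:0, \<alpha>:] * [:0, \<alpha>:] ^ ?e * [:0, \<alpha>:] ^ ?e * (odd_part (\<alpha> ^ p) n \<circ>\<^sub>p monom 1 p)"
    by (simp only: Suc mult.assoc)
  finally show "even_part \<alpha> (p * Suc n) = even_part (\<alpha> ^ p) (Suc n) \<circ>\<^sub>p monom 1 p"
    by (simp only: e even_part.simps pcompose_add pcompose_mult)
  have "odd_part \<alpha> (p * Suc n) = odd_part \<alpha> (p * n) + [:0, \<alpha>:] ^ ?e * even_part \<alpha> (p * n)"
    using parts_add(2)[of \<alpha> p "p * n"] by (simp only: mult_Suc_right parts_char[OF p] mult_1_left)
  then show "odd_part \<alpha> (p * Suc n) = [:0, \<alpha>:] ^ ?e * (odd_part (\<alpha> ^ p) (Suc n) \<circ>\<^sub>p monom 1 p)"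
    by (simp only: Suc odd_part.simps pcompose_add distrib_left add.commute)
qed (simp_all add: pcompose_1)

lemma pcompose_power: "(f ^ n) \<circ>\<^sub>p g = (f \<circ>\<^sub>p g) ^ n"
  by (induction n) (simp_all add: pcompose_1 pcompose_mult)

lemma parts_char_power:
  fixes \<alpha> :: "'a::{comm_ring_1,semiring_prime_char}"
  assumes p: "p = CHAR('a)" "odd p"
  shows "even_part \<alpha> (p ^ i) = 1" "odd_part \<alpha> (p ^ i) = [:0, \<alpha>:] ^ ((p ^ i - 1) div 2)"
proof (induction i arbitrary: \<alpha>)
  case (Suc i)
  { case 1 show ?case by (simp add: Suc parts_char_mult[OF p] pcompose_1) }
  { case 2
    have odd: "odd (p ^ i)" using p(2) by simp
    obtain a where a: "p = 2 * a + 1" using p(2) by (elim oddE)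
    obtain b where b: "p ^ i = 2 * b + 1" using odd by (elim oddE)
    note ab = a b
    have "(p ^ Suc i - 1) div 2 = (p - 1) div 2 + p * ((p ^ i - 1) div 2)"
      unfolding power_Suc ab(2) by (simp add: a algebra_simps)
    moreover have "[:0, \<alpha> ^ p:] \<circ>\<^sub>p monom 1 p = [:0, \<alpha>:] ^ p"
      by (simp add: pcompose_pCons smult_monom monom_altdef flip: smult_power)
    ultimately show ?case
      by (simp add: Suc parts_char_mult[OF p] power_mult power_add pcompose_power) }
qed simp_all

section \<open>Coincidences between even and odd parts\<close>

lemma poly_even_part_root_nonzero:
  fixes \<alpha> :: "'a::field"
  assumes "\<alpha> * z = 1" "(2::'a) \<noteq> 0"
  shows "poly (even_part \<alpha> n) z \<noteq> 0"
  using assms parts_at_root(1)[OF assms(1), of n] by (cases "n = 0") auto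

text \<open>
  The linear factor is prime and does not divide $D$, since $D$ does not vanish at its root.
\<close>

lemma dvd_linear_power_cancel:
  fixes D N :: "'a::field poly"
  assumes "D dvd [:1, -\<alpha>:] ^ k * N" "\<alpha> * z = 1" "poly D z \<noteq> 0"
  shows "D dvd N"
  using assms(1)
proof (induction k)
  case (Suc k)
  then obtain S where S: "[:1, -\<alpha>:] * ([:1, -\<alpha>:] ^ k * N) = D * S"
    unfolding power_Suc mult.assoc by (elim dvdE)
  have "poly [:1, -\<alpha>:] z = 0" using assms(2) by (simp add: mult.commute)
  then have "poly (D * S) z = 0" unfolding S[symmetric] poly_mult by simp
  then have "poly S z = 0" using assms by simp
  then obtain T where T: "S = [:-z, 1:] * T" by (auto simp: poly_eq_0_iff_dvd)
  have "[:1, -\<alpha>:] = smult (-\<alpha>) [:-z, 1:]" using assms(2) by simp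
  then have "[:-z, 1:] * smult (-\<alpha>) ([:1, -\<alpha>:] ^ k * N) = [:-z, 1:] * (D * T)"
    using S unfolding T by (metis mult.left_commute mult_smult_left mult_smult_right)
  then have "smult (-\<alpha>) ([:1, -\<alpha>:] ^ k * N) = D * T"
    by (subst (asm) mult_left_cancel) auto
  then have "D dvd smult (-\<alpha>) ([:1, -\<alpha>:] ^ k * N)" by simp
  moreover have "\<alpha> \<noteq> 0" using assms(2) by auto
  ultimately show ?case using Suc.IH by (simp add: dvd_smult_iff)
qed simp

text \<open>
  Fractions $g/f$ are determined by reduced numerators and denominators: $f$ and $g$ are coprime because a common factor
  would divide $f^2 - \alpha h g^2 = (1 - \alpha h)^m$, and $f$ does not vanish at $1/\alpha$. The
  remaining scalar is fixed by $f(0) = 1$.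
\<close>

lemma parts_proportional_imp_eq:
  fixes \<alpha> \<beta> :: "'a::field"
  assumes nz: "\<alpha> \<noteq> 0" "\<beta> \<noteq> 0" "(2::'a) \<noteq> 0"
    and eq: "even_part \<alpha> m * odd_part \<beta> n = odd_part \<alpha> m * even_part \<beta> n"
  shows "even_part \<alpha> m = even_part \<beta> n" "odd_part \<alpha> m = odd_part \<beta> n"
proof -
  have dvd: "even_part a i dvd even_part b j" 
    if e: "even_part a i * odd_part b j = odd_part a i * even_part b j" and a: "a \<noteq> 0" for a b :: 'a and i j
  proof -
    let ?F = "even_part a i" and ?G = "odd_part a i" and ?F' = "even_part b j" and ?G' = "odd_part b j"
    have "[:1, -a:] ^ i * ?F' = ?F * (?F * ?F') - [:0, a:] * ?G * (?G * ?F')"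
      unfolding norm_parts[symmetric] by (simp only: power2_eq_square algebra_simps)
    also have "\<dots> = ?F * (?F * ?F' - [:0, a:] * ?G * ?G')"
      unfolding e[symmetric] by (simp only: algebra_simps)
    finally have "?F dvd [:1, -a:] ^ i * ?F'" by simp
    then show ?thesis
      by (rule dvd_linear_power_cancel[of _ _ _ _ "inverse a"])
         (use a nz poly_even_part_root_nonzero[of a "inverse a"] in auto)
  qed
  have c0: "coeff (even_part a i) 0 = 1" for a :: 'a and i by (simp add: coeff_parts)
  then have ne: "even_part a i \<noteq> 0" for a :: 'a and i by (metis coeff_0 zero_neq_one)
  have "even_part \<beta> n dvd even_part \<alpha> m"
    using dvd[of \<beta> n \<alpha> m] eq nz(2) by (metis mult.commute)
  then obtain S where S: "even_part \<alpha> m = even_part \<beta> n * S" by (elim dvdE)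
  have "degree (even_part \<alpha> m) \<le> degree (even_part \<beta> n)"
    using dvd[OF eq nz(1)] ne by (intro dvd_imp_degree_le)
  moreover have "S \<noteq> 0" using S ne[of \<alpha> m] by auto
  ultimately have "degree S = 0" using ne[of \<beta> n] by (simp add: S degree_mult_eq)
  then obtain s where s: "S = [:s:]" by (elim degree_eq_zeroE)
  have "coeff (even_part \<alpha> m) 0 = s * coeff (even_part \<beta> n) 0" by (simp add: S s)
  then have "s = 1" by (simp only: c0 mult_1_right)
  then show *: "even_part \<alpha> m = even_part \<beta> n" by (simp add: S s)
  show "odd_part \<alpha> m = odd_part \<beta> n"
    using eq ne[of \<beta> n] by (simp add: * mult.commute)
qed

text \<open>
  The Wronskian of $P$ and $Q$ is alternating and both lie in the span of $F^2$ and $h G^2$, so it is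
  a constant multiple of the Wronskian of $F^2$ and $h G^2$, in which $F G$ is a factor.
\<close>

lemma even_odd_dvd_wronskian:
  fixes F G :: "'a::idom poly" and a b :: 'a
  defines "P \<equiv> F ^ 2 - [:0, a:] * G ^ 2" and "Q \<equiv> F ^ 2 - [:0, b:] * G ^ 2"
  shows "F * G dvd pderiv P * Q - P * pderiv Q"
proof -
  let ?X = "[:0, 1:]"
  have P: "F ^ 2 - [:0, c:] * G ^ 2 = F * F - [:c:] * (?X * (G * G))" for c
    by (simp add: power2_eq_square)
  have d: "pderiv (F ^ 2 - [:0, c:] * G ^ 2) = 2 * F * pderiv F - [:c:] * (G * G + 2 * ?X * G * pderiv G)" for c
    unfolding P pderiv_diff pderiv_mult by (simp add: pderiv_pCons algebra_simps flip: pCons_one)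
  have "pderiv P * Q - P * pderiv Q = 
      F * G * (([:a:] - [:b:]) * (2 * ?X * pderiv F * G - F * G - 2 * ?X * F * pderiv G))"
    unfolding P_def Q_def d unfolding P
    by (simp only: algebra_simps mult_2)
  then show ?thesis by (simp only: dvd_triv_left)
qed

text \<open>
  The two leading coefficients are $1$ and $n$, up to powers of $\alpha$.
\<close>

lemma degree_parts_ge:
  fixes \<alpha> :: "'a::field"
  assumes "\<alpha> \<noteq> 0" "of_nat n \<noteq> (0::'a)"
  shows "n \<le> degree (even_part \<alpha> n) + degree (odd_part \<alpha> n) + 1"
proof (cases "even n")
  case True
  then obtain k where k: "n = 2 * k" by blast
  with assms have "k \<ge> 1" by (cases k) auto
  then have k': "2 * (k - 1) + 1 = n - 1" using k by auto
  have "coeff (even_part \<alpha> n) k \<noteq> 0" using assms by (simp add: coeff_parts flip: k)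
  moreover have "n choose (n - 1) = n" using k \<open>k \<ge> 1\<close> binomial_symmetric[of 1 n] by simp
  then have "coeff (odd_part \<alpha> n) (k - 1) \<noteq> 0" unfolding coeff_parts k' using assms by simp
  ultimately have "k \<le> degree (even_part \<alpha> n)" "k - 1 \<le> degree (odd_part \<alpha> n)"
    by (auto intro: le_degree)
  then show ?thesis using k by linarith
next
  case False
  then obtain k where k: "n = 2 * k + 1" by (elim oddE)
  have "coeff (odd_part \<alpha> n) k \<noteq> 0" using assms(1) unfolding coeff_parts k[symmetric] by simp
  moreover have "n choose (2 * k) = n" using k by simp
  then have "coeff (even_part \<alpha> n) k \<noteq> 0" unfolding coeff_parts using assms by simp
  ultimately have "k \<le> degree (even_part \<alpha> n)" "k \<le> degree (odd_part \<alpha> n)"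
    by (auto intro: le_degree)
  then show ?thesis using k by linarith
qed

text \<open>
  The separable case, an argument in the spirit of the Mason-Stothers theorem. The Wronskian of
  $P = (1 - \alpha h)^m$ and $Q = (1 - \beta h)^n$ is $(1 - \alpha h)^{m-1} (1 - \beta h)^{n-1} N$ with
  $N$ nonzero of degree at most $1$. By the previous lemmas it is divisible by $F G$, which is coprime to both
  linear factors, so $F G$ divides $N$. The scalar $k$ is kept for the sake of the descent below,
  which changes the ratio of the odd parts.
\<close>

lemma parts_eq_imp_trivial_exponents:
  fixes \<alpha> \<beta> k :: "'a::field"
  assumes nz: "\<alpha> \<noteq> 0" "\<beta> \<noteq> 0" "(2::'a) \<noteq> 0" "of_nat m \<noteq> (0::'a)" "of_nat n \<noteq> (0::'a)"
    and ne: "\<alpha> \<noteq> \<beta>"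
    and even: "even_part \<alpha> m = even_part \<beta> n"
    and odd: "odd_part \<alpha> m = smult k (odd_part \<beta> n)"
  shows "m = 1 \<and> n = 1"
proof -
  define F where "F = even_part \<alpha> m"
  define G where "G = odd_part \<alpha> m"
  define P where "P = [:1, -\<alpha>:] ^ m"
  define Q where "Q = [:1, -\<beta>:] ^ n"
  define N where "N = [:of_nat n * \<beta> - of_nat m * \<alpha>, \<alpha> * \<beta> * (of_nat m - of_nat n):]"
  have mn: "m \<ge> 1" "n \<ge> 1" using nz(4,5) by (cases m; cases n; simp)+
  have k: "k \<noteq> 0" using arg_cong[OF odd, of "\<lambda>f. coeff f 0"] nz(4) by (auto simp: coeff_parts)
  have P: "P = F ^ 2 - [:0, \<alpha>:] * G ^ 2" by (simp only: P_def F_def G_def norm_parts)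
  have G': "odd_part \<beta> n = smult (inverse k) G" using odd k by (simp add: G_def)
  have Q: "Q = F ^ 2 - [:0, \<beta> * inverse k ^ 2:] * G ^ 2"
    unfolding Q_def norm_parts[symmetric] G' F_def even by (simp add: power2_eq_square mult_ac)
  have "F * G dvd pderiv P * Q - P * pderiv Q"
    unfolding P Q by (rule even_odd_dvd_wronskian)
  also have "pderiv P * Q - P * pderiv Q = [:1, -\<alpha>:] ^ (m - 1) * ([:1, -\<beta>:] ^ (n - 1) * N)"
  proof -
    have pd: "pderiv ([:1, -c:] ^ Suc i) = [:1, -c:] ^ i * [:- of_nat (Suc i) * c:]" for c :: 'a and i
      by (simp add: pderiv_power_Suc pderiv_pCons algebra_simps smult_add_left smult_diff_left del: power_Suc)
    obtain m' n' where m': "m = Suc m'" "n = Suc n'" using mn by (metis One_nat_def Suc_le_D)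
    have N: "N = [:- of_nat m * \<alpha>:] * [:1, -\<beta>:] - [:1, -\<alpha>:] * [:- of_nat n * \<beta>:]"
      unfolding N_def by (simp add: algebra_simps)
    have "A * a * (L' * B) - (L * A) * (B * b) = A * (B * (a * L' - L * b))" for A B L L' a b :: "'a poly"
      by (simp only: algebra_simps)
    from this[of "[:1, -\<alpha>:] ^ m'" "[:- of_nat m * \<alpha>:]" "[:1, -\<beta>:]" "[:1, -\<beta>:] ^ n'" "[:1, -\<alpha>:]" "[:- of_nat n * \<beta>:]"]
    show ?thesis
      unfolding P_def Q_def N m' pd diff_Suc_1 unfolding power_Suc .
  qed
  finally have "F * G dvd [:1, -\<alpha>:] ^ (m - 1) * ([:1, -\<beta>:] ^ (n - 1) * N)" .
  then have "F * G dvd [:1, -\<beta>:] ^ (n - 1) * N"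
    by (rule dvd_linear_power_cancel[of _ _ _ _ "inverse \<alpha>"])
       (use nz mn in \<open>simp_all add: F_def G_def parts_at_root\<close>)
  then have "F * G dvd N"
    by (rule dvd_linear_power_cancel[of _ _ _ _ "inverse \<beta>"])
       (use nz mn k in \<open>simp_all add: F_def G_def even odd parts_at_root\<close>)
  moreover have "N \<noteq> 0"
  proof
    assume "N = 0"
    then have "of_nat m = (of_nat n :: 'a)" "of_nat n * \<beta> = of_nat m * \<alpha>"
      using nz by (auto simp: N_def)
    then show False using nz ne by auto
  qed
  ultimately have "degree (F * G) \<le> 1"
    using dvd_imp_degree_le[of "F * G" N] by (auto simp: N_def split: if_splits)
  moreover have "F * G \<noteq> 0" using \<open>F * G dvd N\<close> \<open>N \<noteq> 0\<close> by auto
  ultimately have deg: "degree F + degree G \<le> 1" by (auto simp: degree_mult_eq)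
  have "m \<le> 2" using degree_parts_ge[of \<alpha> m] nz deg by (simp add: F_def G_def)
  have "n \<le> 2" using degree_parts_ge[of \<beta> n] nz deg k by (simp add: F_def G_def even odd)
  \<comment> \<open>The linear coefficients of the even parts exclude the exponent 2.\<close>
  have "of_nat (m choose 2) * \<alpha> = of_nat (n choose 2) * \<beta>"
    using arg_cong[OF even, of "\<lambda>f. coeff f 1"] by (simp add: coeff_parts)
  moreover have "m = 1 \<or> m = 2" "n = 1 \<or> n = 2" using mn \<open>m \<le> 2\<close> \<open>n \<le> 2\<close> by auto
  ultimately show ?thesis using nz ne by (auto simp: binomial_eq_0)
qed

text \<open>
  Descent on $m$. The constant coefficients of the odd parts are $m$ and $kn$, so $p$ divides both
  exponents or neither; in the first case the equations for $(m, n, \alpha, \beta)$ are the $p$-th power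
  substitution of those for $(m/p, n/p, \alpha^p, \beta^p)$.
\<close>

lemma parts_eq_imp_char_power:
  fixes \<alpha> \<beta> k :: "'a::field_prime_char"
  assumes p: "p = CHAR('a)" "odd p" 
    and nz: "\<alpha> \<noteq> 0" "\<beta> \<noteq> 0" "\<alpha> \<noteq> \<beta>" and "m \<ge> 1" "n \<ge> 1"
    and even: "even_part \<alpha> m = even_part \<beta> n"
    and odd: "odd_part \<alpha> m = smult k (odd_part \<beta> n)" and "k \<noteq> 0"
  shows "\<exists>i. m = p ^ i \<and> n = p ^ i"
  using assms(3-)
proof (induction m arbitrary: n \<alpha> \<beta> k rule: less_induct)
  case (less m)
  have pr: "prime p" using p by simp
  have two: "(2::'a) \<noteq> 0" using two_nonzero_of_odd_char p by blast
  have mn: "of_nat m = k * of_nat n"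
    using arg_cong[OF less.prems(7), of "\<lambda>f. coeff f 0"] by (simp add: coeff_parts)
  show ?case
  proof (cases "of_nat m = (0::'a)")
    case False
    then have "m = 1 \<and> n = 1"
      using less.prems two mn by (intro parts_eq_imp_trivial_exponents[of \<alpha> \<beta> m n k]) auto
    then show ?thesis by (metis power_0)
  next
    case True
    then have "of_nat n = (0::'a)" using mn less.prems by auto
    with True obtain m' n' where m': "m = p * m'" "n = p * n'"
      by (auto simp: of_nat_eq_0_iff_char_dvd p dvd_def)
    let ?e = "(p - 1) div 2"
    have pos: "degree (monom (1::'a) p) > 0" using pr by (simp add: degree_monom_eq prime_gt_0_nat)
    have "(even_part (\<alpha> ^ p) m' - even_part (\<beta> ^ p) n') \<circ>\<^sub>p monom 1 p = 0"
      using less.prems(6) by (simp add: m' parts_char_mult[OF p] pcompose_diff)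
    then have e: "even_part (\<alpha> ^ p) m' = even_part (\<beta> ^ p) n'"
      using pos by (simp add: pcompose_eq_0_iff)
    \<comment> \<open>The factors \<open>h^((p-1)/2)\<close> cancel; what remains of them changes the scalar \<open>k\<close>.\<close>
    have X: "[:0, c:] ^ ?e = smult (c ^ ?e) ([:0, 1:] ^ ?e)" for c :: 'a
      by (simp flip: smult_power)
    have "[:0, 1:] ^ ?e * ((smult (\<alpha> ^ ?e) (odd_part (\<alpha> ^ p) m')
        - smult (k * \<beta> ^ ?e) (odd_part (\<beta> ^ p) n')) \<circ>\<^sub>p monom 1 p) = 0"
      using less.prems(7)
      unfolding m' parts_char_mult[OF p] X[of \<alpha>] X[of \<beta>]
      by (simp add: pcompose_diff pcompose_smult algebra_simps)
    then have "smult (\<alpha> ^ ?e) (odd_part (\<alpha> ^ p) m') = smult (k * \<beta> ^ ?e) (odd_part (\<beta> ^ p) n')"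
      using pos by (simp add: pcompose_eq_0_iff)
    then have o: "odd_part (\<alpha> ^ p) m' = smult (inverse (\<alpha> ^ ?e) * (k * \<beta> ^ ?e)) (odd_part (\<beta> ^ p) n')"
      using less.prems(1) by (metis (no_types) left_inverse power_not_zero smult_1_left smult_smult)
    have "\<alpha> ^ p \<noteq> \<beta> ^ p"
    proof
      assume "\<alpha> ^ p = \<beta> ^ p"
      moreover have "(\<alpha> - \<beta> + \<beta>) ^ p = (\<alpha> - \<beta>) ^ p + \<beta> ^ p"
        by (rule freshmans_dream) (use p in auto)
      ultimately show False using less.prems(3) by simp
    qed
    then have "\<exists>i. m' = p ^ i \<and> n' = p ^ i"
      using less.prems m' prime_gt_1_nat[OF pr]
      by (intro less.IH[OF _ _ _ _ _ _ e o]) auto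
    then show ?thesis unfolding m' by (metis power_Suc)
  qed
qed

section \<open>Finite fields and the number \<open>k\<^sub>\<tau>\<close>\<close>

lemma CHAR_of_card_prime_power:
  assumes "prime p" "CARD('a::finite_field) = p ^ m"
  shows "CHAR('a) = p"
proof -
  have "(\<Sum>y\<in>UNIV. y + 1 :: 'a) = (\<Sum>y\<in>UNIV. y)"
    by (rule sum.reindex_bij_witness[of _ "\<lambda>y. y - 1" "\<lambda>y. y + 1"]) auto
  then have "of_nat CARD('a) = (0 :: 'a)" by (simp add: sum.distrib)
  then have "CHAR('a) dvd p ^ m" by (simp only: of_nat_eq_0_iff_char_dvd assms(2))
  then have "CHAR('a) dvd p" by (rule prime_dvd_power[OF CHAR_prime])
  then show ?thesis using assms(1) CHAR_prime[where 'a = 'a] primes_dvd_imp_eq by blast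
qed

lemma half_pow_minus_one_add:
  fixes p :: nat
  assumes "odd p"
  shows "(p ^ (i + j) - 1) div 2 = ((p ^ i - 1) div 2) * p ^ j + (p ^ j - 1) div 2"
proof -
  obtain a b where "p ^ i = 2 * a + 1" "p ^ j = 2 * b + 1"
    using assms by (metis even_power oddE)
  then show ?thesis by (simp add: power_add algebra_simps)
qed

text \<open>
  Write $Q(i)$ for the property on the left. As $(p^{i+j}-1)/2 = p^j (p^i-1)/2 + (p^j-1)/2$ and taking
  $p^j$-th powers is injective, $Q(j)$ implies $Q(i + j) \longleftrightarrow Q(i)$. So $Q$ holds exactly for
  the multiples of its least positive instance, which exists since $Q(2m)$ follows from Fermat's
  little theorem for $\mathbb{F}_q$ with $q = p^m$.
\<close>

lemma power_half_eq_1_iff_k_exp_dvd: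
  fixes \<tau> :: "'a::finite_field"
  assumes p: "prime p" "odd p" and card: "CARD('a) = p ^ m" and \<tau>: "\<tau> \<noteq> 0" "\<tau> \<noteq> 1"
  shows "(\<tau> / (\<tau> - 1)) ^ ((p ^ i - 1) div 2) = 1 \<longleftrightarrow> k_exp p \<tau> dvd i"
proof -
  define \<rho> where "\<rho> = \<tau> / (\<tau> - 1)"
  define Q where "Q i \<longleftrightarrow> \<rho> ^ ((p ^ i - 1) div 2) = 1" for i
  define k where "k = k_exp p \<tau>"
  have \<rho>: "\<rho> \<noteq> 0" using \<tau> by (simp add: \<rho>_def)
  have char: "p = CHAR('a)" using CHAR_of_card_prime_power p card by metis
  have fr: "x ^ (p ^ j) = 1 \<longleftrightarrow> x = 1" for x :: 'a and j
  proof
    assume *: "x ^ (p ^ j) = 1"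
    have "((x - 1) + 1) ^ (p ^ j) = (x - 1) ^ (p ^ j) + 1 ^ (p ^ j)"
      by (rule freshmans_dream') (use char in auto)
    then show "x = 1" using * by simp
  qed simp
  have add: "Q (i + j) \<longleftrightarrow> Q i" if "Q j" for i j
    using that by (simp only: Q_def half_pow_minus_one_add[OF p(2)] power_add[of \<rho>] power_mult fr mult_1_right)
  have "m \<noteq> 0"
  proof
    assume "m = 0"
    then have "CARD('a) = 1" using card by simp
    then show False using \<tau> by (metis UNIV_I card_1_singletonE singletonD)
  qed
  have "\<exists>k. 0 < k \<and> Q k"
  proof (intro exI conjI)
    show "0 < 2 * m" using \<open>m \<noteq> 0\<close> by simp
    obtain b where b: "p ^ m = 2 * b + 1" using p(2) by (metis even_power oddE)
    have "\<rho> * \<rho> ^ (2 * b) = \<rho>"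
      using finite_field_power_card_eq_same[of \<rho>] unfolding card b by simp
    then have "\<rho> ^ (2 * b) = 1" using \<rho> by simp
    moreover have "(p ^ (2 * m) - 1) div 2 = 2 * b * (b + 1)"
      unfolding power_mult power_mult[of p m 2] mult.commute[of 2 m] by (simp add: b power2_eq_square)
    ultimately show "Q (2 * m)" unfolding Q_def by (simp only: power_mult power_one)
  qed
  then have k: "0 < k" "Q k" and least: "\<And>j. 0 < j \<Longrightarrow> Q j \<Longrightarrow> k \<le> j"
    unfolding k_def k_exp_def \<rho>_def[symmetric] Q_def[symmetric]
    by (auto intro: LeastI2_ex Least_le dest: LeastI_ex)
  have Q0: "Q 0" by (simp add: Q_def)
  have mult: "Q (i + k * l) \<longleftrightarrow> Q i" for i l
    by (induction l) (use add[OF k(2)] in \<open>simp_all add: add.assoc[symmetric] add.commute[of _ "k * _"]\<close>)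
  have "Q i \<longleftrightarrow> Q (i mod k)"
    using mult[of "i mod k" "i div k"] by (simp add: add.commute)
  also have "\<dots> \<longleftrightarrow> i mod k = 0"
    using least[of "i mod k"] k(1) Q0 by (metis gr0I mod_less_divisor not_le)
  finally show ?thesis by (simp add: Q_def \<rho>_def k_def dvd_eq_mod_eq_0)
qed

text \<open>
  Euler's criterion. The polynomial $x^e - 1$ has at most $e$ roots, and the $e$ nonzero squares are
  such roots already.
\<close>

lemma nonsquare_power_half:
  fixes c :: "'a::finite_field"
  assumes card: "CARD('a) = 2 * e + 1" and c: "c \<noteq> 0" "\<not> (\<exists>x. c = x ^ 2)"
  shows "c ^ e = -1"
proof -
  define S where "S = (\<lambda>x::'a. x ^ 2) ` (UNIV - {0})"
  define R where "R = {x::'a. poly (monom 1 e - 1) x = 0}"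
  have R: "x \<in> R \<longleftrightarrow> x ^ e = 1" for x by (simp add: R_def poly_monom)
  have fermat: "x ^ (2 * e) = 1" if "x \<noteq> 0" for x :: 'a
    using finite_field_power_card_eq_same[of x] that unfolding card by simp
  have "e \<noteq> 0" 
  proof
    assume "e = 0"
    then have "CARD('a) = 1" using card by simp
    then have "c = 0" by (metis (full_types) UNIV_I card_1_singletonE singletonD)
    then show False using c by simp
  qed
  have sq: "(x ^ 2) ^ e = 1" if "x \<noteq> 0" for x :: 'a
    using fermat[OF that] by (simp only: power_mult)
  have "c \<notin> R"
  proof
    assume "c \<in> R"
    have "insert c S \<subseteq> R"
      using \<open>c \<in> R\<close> by (simp add: R S_def image_subset_iff sq del: power_mult)
    moreover have "c \<notin> S" using c by (auto simp: S_def)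
    moreover have "card R \<le> e"
    proof -
      have "degree (monom 1 e - 1 :: 'a poly) \<le> e"
        by (intro degree_diff_le) (auto simp: degree_monom_le)
      moreover have "monom 1 e - 1 \<noteq> (0 :: 'a poly)"
      proof
        assume "monom 1 e - 1 = (0 :: 'a poly)"
        then have "coeff (monom 1 e - 1 :: 'a poly) e = coeff 0 e" by (rule arg_cong)
        then show False using \<open>e \<noteq> 0\<close> by simp
      qed
      then have "card R \<le> degree (monom 1 e - 1 :: 'a poly)"
        unfolding R_def by (rule card_poly_roots_bound)
      ultimately show ?thesis by linarith
    qed
    moreover have "2 * e \<le> 2 * card S"
    proof -
      have "card (UNIV - {0 :: 'a}) \<le> (\<Sum>y\<in>S. card {x \<in> UNIV - {0}. x ^ 2 = y})"
        using sum.image_gen[of "UNIV - {0 :: 'a}" "\<lambda>_. 1::nat" "\<lambda>x. x ^ 2"] by (simp add: S_def)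
      also have "\<dots> \<le> (\<Sum>y\<in>S. 2)"
      proof (rule sum_mono)
        fix y assume "y \<in> S"
        then obtain z where "y = z ^ 2" by (auto simp: S_def)
        then have "{x \<in> UNIV - {0}. x ^ 2 = y} \<subseteq> {z, -z}" by (auto simp: power2_eq_iff)
        then show "card {x \<in> UNIV - {0}. x ^ 2 = y} \<le> 2"
          using card_mono[of "{z, -z}" "{x \<in> UNIV - {0}. x ^ 2 = y}"] card_insert_le_m1[of 2 "{-z}" z] by simp
      qed
      finally show ?thesis using card by (simp add: card_Diff_singleton)
    qed
    ultimately show False
      using card_mono[of R "insert c S"] by (simp add: card_insert_if)
  qed
  moreover have "(c ^ e) ^ 2 = 1" using fermat[OF c(1)] by (simp add: mult.commute flip: power_mult)
  ultimately show ?thesis by (auto simp: R power2_eq_1_iff)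
qed

section \<open>Quaternions with polynomial coordinates\<close>

text \<open>
  The quadruple $(x_0, x_1, x_2, x_3)$ of polynomials in $h$ stands for
  $x_0 + x_1 Z + (x_2 + x_3 Z) F / t$. Since $(F/t)^2 = (t-1)/t = h$, this is the quaternion algebra
  $(c, h)$ over the polynomial ring; its multiplication is spelled out because the one for quaternions
  over a field does not apply to polynomials.
\<close>

fun pquat_mult :: "'a::comm_ring_1 \<Rightarrow> 'a poly quat \<Rightarrow> 'a poly quat \<Rightarrow> 'a poly quat" where
  "pquat_mult c (Quat x0 x1 x2 x3) (Quat y0 y1 y2 y3) = Quat
     (x0 * y0 + [:c:] * x1 * y1 + [:0, 1:] * x2 * y2 - [:c:] * [:0, 1:] * x3 * y3)
     (x0 * y1 + x1 * y0 - [:0, 1:] * x2 * y3 + [:0, 1:] * x3 * y2)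
     (x0 * y2 + x2 * y0 + [:c:] * x1 * y3 - [:c:] * x3 * y1)
     (x0 * y3 + x3 * y0 + x1 * y2 - x2 * y1)"

fun pquat_norm :: "'a::comm_ring_1 \<Rightarrow> 'a poly quat \<Rightarrow> 'a poly" where
  "pquat_norm c (Quat x0 x1 x2 x3) =
     x0 ^ 2 - [:c:] * x1 ^ 2 - [:0, 1:] * x2 ^ 2 + [:c:] * [:0, 1:] * x3 ^ 2"

fun pquat_conj :: "'a::comm_ring_1 poly quat \<Rightarrow> 'a poly quat" where
  "pquat_conj (Quat x0 x1 x2 x3) = Quat x0 (-x1) (-x2) (-x3)"

fun pquat_re :: "'a::comm_ring_1 poly quat \<Rightarrow> 'a poly" where
  "pquat_re (Quat x0 x1 x2 x3) = x0"

text \<open>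
  The pair $X = (u, v)$ stands for $(u + vZ) F / t$, whose square is \<open>nu c X\<close> times $h$.
\<close>

definition nu :: "'a::comm_ring_1 \<Rightarrow> 'a \<times> 'a \<Rightarrow> 'a" where
  "nu c X = fst X ^ 2 - c * snd X ^ 2"

text \<open>
  The coordinates of $(1 + X)^n$: as $X^2 = \nu h$, this power is $f + g X$ with the even part $f$ and the
  odd part $g$.
\<close>

definition one_plus_power :: "'a::comm_ring_1 \<Rightarrow> 'a \<times> 'a \<Rightarrow> nat \<Rightarrow> 'a poly quat" where
  "one_plus_power c X n = (let g = odd_part (nu c X) n in 
      Quat (even_part (nu c X) n) 0 (smult (fst X) g) (smult (snd X) g))"

lemma pquat_norm_mult: "pquat_norm c (pquat_mult c x y) = pquat_norm c x * pquat_norm c y"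
proof -
  have "(x0 * y0 + C * x1 * y1 + H * x2 * y2 - C * H * x3 * y3) ^ 2
     - C * (x0 * y1 + x1 * y0 - H * x2 * y3 + H * x3 * y2) ^ 2
     - H * (x0 * y2 + x2 * y0 + C * x1 * y3 - C * x3 * y1) ^ 2
     + C * H * (x0 * y3 + x3 * y0 + x1 * y2 - x2 * y1) ^ 2
    = (x0 ^ 2 - C * x1 ^ 2 - H * x2 ^ 2 + C * H * x3 ^ 2) 
      * (y0 ^ 2 - C * y1 ^ 2 - H * y2 ^ 2 + C * H * y3 ^ 2)"
    for x0 x1 x2 x3 y0 y1 y2 y3 C H :: "'a poly"
    by (simp only: power2_eq_square algebra_simps)
  then show ?thesis
    by (cases x; cases y) (simp only: pquat_mult.simps pquat_norm.simps)
qed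

lemma pquat_norm_one_plus_power: "pquat_norm c (one_plus_power c X n) = [:1, - nu c X:] ^ n"
  unfolding one_plus_power_def Let_def pquat_norm.simps norm_parts[symmetric] nu_def
  by (simp add: power2_eq_square algebra_simps smult_diff_left)

lemma one_plus_power_product:
  "pquat_mult c (one_plus_power c (u, v) m) (one_plus_power c (u', v') n) =
    (let f = even_part (nu c (u, v)) m; g = odd_part (nu c (u, v)) m;
         f' = even_part (nu c (u', v')) n; g' = odd_part (nu c (u', v')) n
     in Quat (f * f' + [:0, u * u' - c * v * v':] * (g * g')) ([:0, v * u' - u * v':] * (g * g'))
         (smult u' (f * g') + smult u (g * f')) (smult v' (f * g') + smult v (g * f')))"
  unfolding one_plus_power_def Let_def fst_conv snd_conv pquat_mult.simps
  by (simp add: algebra_simps smult_diff_left)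

lemma one_plus_power_Suc:
  "one_plus_power c X (Suc n) = pquat_mult c (one_plus_power c X n) (one_plus_power c X 1)"
proof -
  obtain u v where X: "X = (u, v)" by (cases X)
  have "u * u - c * v * v = nu c (u, v)" "v * u - u * v = 0"
    by (simp_all add: nu_def power2_eq_square mult.assoc mult.commute[of v u])
  then show ?thesis
    unfolding X one_plus_power_product Let_def
    by (simp only: one_plus_power_def Let_def even_part.simps odd_part.simps One_nat_def fst_conv snd_conv
      mult_1_right mult_zero_right add_0_right smult_add_right pCons_0_0 mult_zero_left)
qed

text \<open>
  At the root $z$ of $1 - \nu(X) h$, the factor $(1 + X)^m$ specialises to $2^{m-1} (1 + X)$. If
  $(1 + X)(f + g Y)$ vanished there, then so would $f u + g u'$ and $f v + g v'$; applying $\nu$ to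
  $f X = - g Y$ gives $f^2 \nu(X) = g^2 \nu(Y)$, whence $(1 - \nu(Y) z)^n = 0$, contrary to the
  choice of $z$.
\<close>

lemma one_plus_power_product_nonzero:
  fixes c :: "'a::field"
  assumes z: "nu c X * z = 1" "nu c Y * z \<noteq> 1" and m: "m \<ge> 1" and two: "(2::'a) \<noteq> 0"
  shows "\<exists>f\<in>set_quat (pquat_mult c (one_plus_power c X m) (one_plus_power c Y n)). poly f z \<noteq> 0" (is ?left)
    and "\<exists>f\<in>set_quat (pquat_mult c (one_plus_power c Y n) (one_plus_power c X m)). poly f z \<noteq> 0" (is ?right)
proof -
  obtain u v u' v' where XY: "X = (u, v)" "Y = (u', v')" by (cases X; cases Y)
  let ?f = "poly (even_part (nu c Y) n) z" and ?g = "poly (odd_part (nu c Y) n) z"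
  have norm: "?f ^ 2 - nu c Y * z * ?g ^ 2 = (1 - nu c Y * z) ^ n"
    using arg_cong[OF norm_parts[of "nu c Y" n], of "\<lambda>f. poly f z"] by (simp add: mult_ac)
  have nz: "?g * u' + ?f * u \<noteq> 0 \<or> ?g * v' + ?f * v \<noteq> 0"
  proof (rule ccontr)
    assume "\<not> ?thesis"
    then have "?f * u = - (?g * u')" "?f * v = - (?g * v')"
      by (simp_all add: add_eq_0_iff)
    then have "(?f * u) ^ 2 - c * (?f * v) ^ 2 = (?g * u') ^ 2 - c * (?g * v') ^ 2" by simp
    then have "?f ^ 2 * nu c X = ?g ^ 2 * nu c Y"
      by (simp add: nu_def XY power_mult_distrib algebra_simps)
    then have "?f ^ 2 * (nu c X * z) = ?g ^ 2 * (nu c Y * z)" by (simp only: mult.assoc[symmetric])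
    then have "?f ^ 2 - nu c Y * z * ?g ^ 2 = 0" unfolding z(1) by (simp add: mult.commute)
    then show False using norm z(2) by simp
  qed
  have root: "poly (even_part (nu c X) m) z = 2 ^ (m - 1)" "poly (odd_part (nu c X) m) z = 2 ^ (m - 1)"
    using parts_at_root[OF z(1) m] .
  have w: "w * (?g * u' + ?f * u) \<noteq> 0 \<or> w * (?g * v' + ?f * v) \<noteq> 0" if "w = 2 ^ (m - 1)" for w
    using nz two that by simp
  show ?left
    using w root unfolding XY one_plus_power_product Let_def by (simp add: algebra_simps)
  show ?right
    using w root unfolding XY one_plus_power_product Let_def by (simp add: algebra_simps)
qed

text \<open>
  The hypotheses on $l$ hold when $L = \lambda R$ for some $\lambda$ in the field of fractions, $N$ and
  $M$ are the norms of $L$ and $R$, and $l = \lambda M$. At a point where $R$ does not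
  vanish, $l R = M L$ shows that $l$ has at least the order of $M$, and symmetrically for $N$; but the
  order of $l$ is the mean of the two.
\<close>

lemma order_norms_eq:
  fixes L R :: "'a::field poly quat"
  assumes LR: "map_quat ((*) l) R = map_quat ((*) M) L" "map_quat ((*) l) L = map_quat ((*) N) R"
    and sq: "l ^ 2 = N * M" and nz: "N \<noteq> 0" "M \<noteq> 0"
    and "Polynomial.order z N > 0 \<Longrightarrow> \<exists>f\<in>set_quat L. poly f z \<noteq> 0"
    and "Polynomial.order z M > 0 \<Longrightarrow> \<exists>f\<in>set_quat R. poly f z \<noteq> 0"
  shows "Polynomial.order z N = Polynomial.order z M"
proof -
  have l: "l \<noteq> 0" using sq nz by auto
  have le: "Polynomial.order z M \<le> Polynomial.order z l"
    if eq: "map_quat ((*) l) R = map_quat ((*) M) L" and M: "M \<noteq> 0" 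
      and ex: "Polynomial.order z M > 0 \<Longrightarrow> \<exists>f\<in>set_quat R. poly f z \<noteq> 0" for L R :: "'a poly quat" and M
  proof (cases "Polynomial.order z M > 0")
    case True
    then obtain f where f: "f \<in> set_quat R" "poly f z \<noteq> 0" using ex by auto
    obtain g where g: "l * f = M * g" using eq f(1) by (cases L; cases R) auto
    have "f \<noteq> 0" using f(2) by auto
    then have "l * f \<noteq> 0" using l by simp
    then have "M * g \<noteq> 0" using g by simp
    then have "Polynomial.order z l + Polynomial.order z f = Polynomial.order z M + Polynomial.order z g"
      using \<open>l * f \<noteq> 0\<close> g order_mult[of l f z] order_mult[of M g z] by simp
    then show ?thesis using f(2) by (simp add: order_0I)
  qed simp
  have "2 * Polynomial.order z l = Polynomial.order z N + Polynomial.order z M"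
    using arg_cong[OF sq, of "Polynomial.order z"] l nz by (simp add: power2_eq_square order_mult)
  then show ?thesis using le[OF LR(1) nz(2) assms(7)] le[OF LR(2) nz(1) assms(6)] by linarith
qed

lemma order_one_minus_power:
  fixes \<alpha> \<beta> z :: "'a::field"
  assumes "\<alpha> * z = 1" "\<beta> * z \<noteq> 1"
  shows "Polynomial.order z ([:1, -\<alpha>:] ^ m * [:1, -\<beta>:] ^ n) = m"
proof -
  have "[:1, -\<alpha>:] = smult (-\<alpha>) [:-z, 1:]" "\<alpha> \<noteq> 0" using assms(1) by auto
  then have "Polynomial.order z ([:1, -\<alpha>:] ^ m) = Polynomial.order z (smult ((-\<alpha>) ^ m) ([:-z, 1:] ^ m))"
    by (simp only: smult_power)
  also have "\<dots> = Polynomial.order z ([:-z, 1:] ^ m)"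
    using \<open>\<alpha> \<noteq> 0\<close> by (simp add: order_smult)
  also have "\<dots> = m" by (rule order_power_n_n)
  finally have "Polynomial.order z ([:1, -\<alpha>:] ^ m) = m" .
  moreover have "Polynomial.order z ([:1, -\<beta>:] ^ n) = 0"
    by (rule order_0I) (use assms in \<open>simp add: mult.commute\<close>)
  ultimately show ?thesis by (subst order_mult) auto
qed

text \<open>
  Comparing orders at $1/\alpha$ and $1/\beta$ gives equal norms, so $l^2 = N^2$ and $L = \pm R$. The
  value $1$ of the scalar coordinate at $h = 0$ decides the sign.
\<close>

lemma power_products_rigid:
  fixes L R :: "'a::field poly quat"
  assumes LR: "map_quat ((*) l) R = map_quat ((*) M) L" "map_quat ((*) l) L = map_quat ((*) N) R"
    and sq: "l ^ 2 = N * M"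
    and N: "N = [:1, -\<alpha>:] ^ m * [:1, -\<beta>:] ^ n" and M: "M = [:1, -\<alpha>:] ^ m' * [:1, -\<beta>:] ^ n'"
    and nz: "\<alpha> \<noteq> 0" "\<beta> \<noteq> 0" "\<alpha> \<noteq> \<beta>" "(2::'a) \<noteq> 0"
    and L: "m > 0 \<Longrightarrow> \<exists>f\<in>set_quat L. poly f (inverse \<alpha>) \<noteq> 0" "n > 0 \<Longrightarrow> \<exists>f\<in>set_quat L. poly f (inverse \<beta>) \<noteq> 0"
    and R: "m' > 0 \<Longrightarrow> \<exists>f\<in>set_quat R. poly f (inverse \<alpha>) \<noteq> 0" "n' > 0 \<Longrightarrow> \<exists>f\<in>set_quat R. poly f (inverse \<beta>) \<noteq> 0"
    and const: "poly (pquat_re L) 0 = 1" "poly (pquat_re R) 0 = 1"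
  shows "m = m' \<and> n = n' \<and> L = R"
proof -
  have NM: "N \<noteq> 0" "M \<noteq> 0" by (simp_all add: N M)
  have \<alpha>: "\<alpha> * inverse \<alpha> = 1" "\<beta> * inverse \<alpha> \<noteq> 1" and \<beta>: "\<beta> * inverse \<beta> = 1" "\<alpha> * inverse \<beta> \<noteq> 1"
    using nz by (auto simp: field_simps)
  have ord\<alpha>: "Polynomial.order (inverse \<alpha>) N = m" "Polynomial.order (inverse \<alpha>) M = m'"
    using order_one_minus_power[OF \<alpha>] by (simp_all add: N M)
  have ord\<beta>: "Polynomial.order (inverse \<beta>) N = n" "Polynomial.order (inverse \<beta>) M = n'"
    using order_one_minus_power[OF \<beta>] by (simp_all add: N M mult.commute[of "[:1, -\<alpha>:] ^ _"])
  have "m = m'" using order_norms_eq[OF LR sq NM, of "inverse \<alpha>"] L R ord\<alpha> by simp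
  moreover have "n = n'" using order_norms_eq[OF LR sq NM, of "inverse \<beta>"] L R ord\<beta> by simp
  moreover from calculation have "N = M" by (simp add: N M)
  then have "l ^ 2 = N ^ 2" using sq by (simp only: power2_eq_square)
  then consider "l = N" | "l = - N" by (auto simp only: power2_eq_iff)
  then have "L = R"
  proof cases
    case 1
    then show ?thesis using LR(1) NM \<open>N = M\<close> by (cases L; cases R) auto
  next
    case 2
    then have "M * (- pquat_re R) = M * pquat_re L" using LR(1) \<open>N = M\<close> by (cases L; cases R) auto
    then have "- pquat_re R = pquat_re L" using NM by (subst (asm) mult_left_cancel) auto
    from arg_cong[OF this, of "\<lambda>f. poly f 0"] have "- 1 = (1 :: 'a)"
      using const by simp
    then have "(2 :: 'a) = 0" by (metis add.left_inverse one_add_one)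
    then show ?thesis using nz by simp
  qed
  ultimately show ?thesis by simp
qed

section \<open>Polynomials in a transcendental element and classes modulo scalars\<close>

lemma const_K_simps [simp]:
  "const_K 0 = 0" "const_K 1 = 1" "const_K (x + y) = const_K x + const_K y"
  "const_K (x * y) = const_K x * const_K y" "const_K (- x) = - const_K x"
  "const_K (x - y) = const_K x - const_K y"
  by (simp_all add: const_K_def one_pCons[symmetric] flip: to_fract_add to_fract_mult to_fract_uminus to_fract_diff)

lemma const_K_power [simp]: "const_K (x ^ n) = const_K x ^ n"
  by (induction n) simp_all

lemma const_K_eq_iff [simp]: "const_K x = const_K y \<longleftrightarrow> x = y"
  by (simp add: const_K_def)

lemma const_K_eq_0_iff [simp]: "const_K x = 0 \<longleftrightarrow> x = 0"
  using const_K_eq_iff[of x 0] by (simp del: const_K_eq_iff)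

lemma t_K_nonzero [simp]: "t_K \<noteq> 0"
  by (simp add: t_K_def)

definition h_K :: "'a::finite_field poly fract" where
  "h_K = (t_K - 1) / t_K"

definition eval_h :: "'a::finite_field poly \<Rightarrow> 'a poly fract" where
  "eval_h f = poly (map_poly const_K f) h_K"

lemma eval_h_pCons: "eval_h (pCons a f) = const_K a + h_K * eval_h f"
  by (simp add: eval_h_def map_poly_pCons)

lemma eval_h_0 [simp]: "eval_h 0 = 0" by (simp add: eval_h_def)

lemma eval_h_const [simp]: "eval_h [:a:] = const_K a" by (simp add: eval_h_pCons)

lemma eval_h_1 [simp]: "eval_h 1 = 1" using eval_h_const[of 1] by (simp add: one_pCons del: eval_h_const)

lemma eval_h_X [simp]: "eval_h [:0, 1:] = h_K" by (simp add: eval_h_pCons)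

lemma eval_h_add [simp]: "eval_h (f + g) = eval_h f + eval_h g"
proof (induction f g rule: poly_induct2)
  case (pCons a f b g)
  then show ?case by (simp add: eval_h_pCons algebra_simps)
qed simp

lemma eval_h_smult [simp]: "eval_h (smult a f) = const_K a * eval_h f"
  by (induction f) (simp_all add: eval_h_pCons algebra_simps)

lemma eval_h_mult [simp]: "eval_h (f * g) = eval_h f * eval_h g"
  by (induction f) (simp_all add: eval_h_pCons algebra_simps)

lemma eval_h_uminus [simp]: "eval_h (- f) = - eval_h f"
  using eval_h_smult[of "-1" f] by simp

lemma eval_h_diff [simp]: "eval_h (f - g) = eval_h f - eval_h g"
  using eval_h_add[of f "- g"] by simp

lemma eval_h_power [simp]: "eval_h (f ^ n) = eval_h f ^ n"
  by (induction n) simp_all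

text \<open>
  Transcendence of $h$: multiplying $f(h)$ by $t^{\deg f}$ gives a polynomial in $t$ whose value at
  $t = 0$ is the leading coefficient of $f$ up to sign, all other terms retaining a factor $t$.
\<close>

lemma eval_h_eq_0_iff [simp]: "eval_h f = 0 \<longleftrightarrow> f = 0"
proof
  assume z: "eval_h f = 0"
  have "\<exists>N. t_K ^ degree f * eval_h f = to_fract N \<and> poly N 0 = (-1) ^ degree f * lead_coeff f"
    for f :: "'a poly"
  proof (induction f)
    case 0
    show ?case by (intro exI[of _ 0]) simp
  next
    case (pCons a f)
    show ?case
    proof (cases "f = 0")
      case True
      show ?thesis by (intro exI[of _ "[:a:]"]) (simp add: True const_K_def)
    next
      case False
      obtain N where N: "t_K ^ degree f * eval_h f = to_fract N" "poly N 0 = (-1) ^ degree f * lead_coeff f"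
        using pCons.IH by blast
      define M where "M = [:a:] * [:0, 1:] ^ Suc (degree f) + [:-1, 1:] * N"
      have tm: "t_K - 1 = to_fract [:-1, 1 :: 'a:]"
      proof -
        have "[:-1, 1:] = [:0, 1:] - (1 :: 'a poly)" by (simp add: one_pCons)
        then show ?thesis by (simp only: t_K_def to_fract_diff to_fract_1)
      qed
      have tp: "to_fract ([:0, 1:] ^ k) = t_K ^ k" for k
        by (induction k) (simp_all only: power_0 to_fract_1 power_Suc to_fract_mult t_K_def)
      have "t_K ^ Suc (degree f) * eval_h (pCons a f)
          = const_K a * t_K ^ Suc (degree f) + (t_K - 1) * (t_K ^ degree f * eval_h f)"
        by (simp add: eval_h_pCons h_K_def field_simps)
      also have "\<dots> = to_fract M"
        unfolding N tm M_def to_fract_add to_fract_mult tp const_K_def ..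
      finally have "t_K ^ degree (pCons a f) * eval_h (pCons a f) = to_fract M"
        using False by simp
      moreover have "poly M 0 = (-1) ^ degree (pCons a f) * lead_coeff (pCons a f)"
        using False by (simp add: M_def N)
      ultimately show ?thesis by blast
    qed
  qed
  then obtain N where "t_K ^ degree f * eval_h f = to_fract N" "poly N 0 = (-1) ^ degree f * lead_coeff f"
    by blast
  then show "f = 0" using z by simp
qed simp

lemma eval_h_eq_iff [simp]: "eval_h f = eval_h g \<longleftrightarrow> f = g"
  using eval_h_eq_0_iff[of "f - g"] by (simp del: eval_h_eq_0_iff)

fun quat_embed :: "'a::finite_field poly quat \<Rightarrow> 'a poly fract quat" where
  "quat_embed (Quat x0 x1 x2 x3) = Quat (eval_h x0) (eval_h x1) (eval_h x2 / t_K) (eval_h x3 / t_K)"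

lemma mult_quat_D: "x \<otimes>\<^bsub>quat_D c\<^esub> y = quat_mult (const_K c) (t_K * (t_K - 1)) x y"
  by (simp add: quat_D_def quaternion_algebra_def)

lemma quat_embed_mult: "quat_embed x \<otimes>\<^bsub>quat_D c\<^esub> quat_embed y = quat_embed (pquat_mult c x y)"
proof -
  have b: "t_K * ((t_K - 1) * z) / t_K / t_K = h_K * z"
    "k * (t_K * ((t_K - 1) * z)) / t_K / t_K = k * (h_K * z)" for k z :: "'a poly fract"
    by (simp_all add: h_K_def)
  show ?thesis unfolding mult_quat_D
    by (cases x; cases y)
       (simp only: quat_embed.simps quat_mult.simps pquat_mult.simps b eval_h_add eval_h_diff eval_h_mult
         eval_h_X eval_h_const quat.inject simp_thms times_divide_eq_right times_divide_eq_left
         add_divide_distrib diff_divide_distrib mult.assoc)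
qed

lemma carrier_quat_D [simp]: "carrier (quat_D c) = UNIV"
  by (simp add: quat_D_def quaternion_algebra_def)

lemma one_quat_D: "\<one>\<^bsub>quat_D c\<^esub> = scalar 1"
  by (simp add: quat_D_def quaternion_algebra_def)

lemma scalar_mult_quat_D:
  "scalar k \<otimes>\<^bsub>quat_D c\<^esub> Quat x0 x1 x2 x3 = Quat (k * x0) (k * x1) (k * x2) (k * x3)"
  "Quat x0 x1 x2 x3 \<otimes>\<^bsub>quat_D c\<^esub> scalar k = Quat (k * x0) (k * x1) (k * x2) (k * x3)"
  by (simp_all add: mult_quat_D scalar_def mult.commute)

lemma pquat_mult_conj:
  "pquat_mult c x (pquat_conj x) = Quat (pquat_norm c x) 0 0 0"
  "pquat_mult c (pquat_conj x) x = Quat (pquat_norm c x) 0 0 0"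
  by (cases x; simp add: power2_eq_square algebra_simps)+

lemma quat_embed_const: "quat_embed (Quat f 0 0 0) = scalar (eval_h f)"
  by (simp add: scalar_def)

text \<open>
  The inverse of $x$ is its conjugate divided by its norm.
\<close>

lemma quat_embed_Units:
  assumes "pquat_norm c x \<noteq> 0"
  shows "quat_embed x \<in> Units (quat_D c)"
proof -
  interpret ring "quat_D c" unfolding quat_D_def by (rule ring_quaternion_algebra)
  let ?n = "eval_h (pquat_norm c x)"
  let ?y = "scalar (inverse ?n) \<otimes>\<^bsub>quat_D c\<^esub> quat_embed (pquat_conj x)"
  have n: "?n \<noteq> 0" using assms by simp
  have sc: "scalar k \<otimes>\<^bsub>quat_D c\<^esub> scalar l = scalar (k * l)" for k l
    by (simp add: mult_quat_D scalar_def)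
  have "quat_embed x \<otimes>\<^bsub>quat_D c\<^esub> ?y = scalar (inverse ?n) \<otimes>\<^bsub>quat_D c\<^esub> (quat_embed x \<otimes>\<^bsub>quat_D c\<^esub> quat_embed (pquat_conj x))"
    using quaternion_algebra_relations(4)[of "const_K c" "t_K * (t_K - 1)" "inverse ?n" "quat_embed x"]
    by (simp add: quat_D_def[symmetric] m_assoc[symmetric])
  then have "quat_embed x \<otimes>\<^bsub>quat_D c\<^esub> ?y = \<one>\<^bsub>quat_D c\<^esub>"
    using n by (simp add: quat_embed_mult pquat_mult_conj quat_embed_const sc one_quat_D del: quat_embed.simps)
  moreover have "?y \<otimes>\<^bsub>quat_D c\<^esub> quat_embed x = \<one>\<^bsub>quat_D c\<^esub>"
    using n by (simp add: m_assoc quat_embed_mult pquat_mult_conj quat_embed_const sc one_quat_D del: quat_embed.simps)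
  ultimately show ?thesis unfolding Units_def by auto
qed

lemma proj_class_mult:
  assumes "x \<in> Units (quat_D c)" "y \<in> Units (quat_D c)"
  shows "proj_class c x \<otimes>\<^bsub>proj_units c\<^esub> proj_class c y = proj_class c (x \<otimes>\<^bsub>quat_D c\<^esub> y)"
  using normal.rcos_sum[OF K_units_normal, of x c y] assms
  by (simp add: proj_units_def proj_class_def FactGroup_def units_of_carrier units_of_mult)

lemma proj_class_carrier:
  assumes "x \<in> Units (quat_D c)"
  shows "proj_class c x \<in> carrier (proj_units c)"
  using assms by (auto simp: proj_units_def proj_class_def FactGroup_def RCOSETS_def units_of_carrier)

lemma proj_class_eq_iff:
  assumes "x \<in> Units (quat_D c)" "y \<in> Units (quat_D c)"
  shows "proj_class c x = proj_class c y \<longleftrightarrow> (\<exists>k. k \<noteq> 0 \<and> x = scalar k \<otimes>\<^bsub>quat_D c\<^esub> y)"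
proof -
  interpret R: ring "quat_D c" unfolding quat_D_def by (rule ring_quaternion_algebra)
  interpret U: group "units_of (quat_D c)" by (rule R.units_group)
  have sub: "subgroup K_units (units_of (quat_D c))" using K_units_normal normal.axioms(1) by blast
  have mem: "x \<in> proj_class c y \<longleftrightarrow> (\<exists>k. k \<noteq> 0 \<and> x = scalar k \<otimes>\<^bsub>quat_D c\<^esub> y)" for x y
    by (auto simp: proj_class_def r_coset_def units_of_mult K_units_def)
  have "proj_class c x = proj_class c y \<longleftrightarrow> x \<in> proj_class c y"
  proof
    assume "proj_class c x = proj_class c y"
    then show "x \<in> proj_class c y"
      using U.rcos_self[OF _ sub, of x] assms by (simp add: proj_class_def units_of_carrier)
  next
    assume "x \<in> proj_class c y"
    then show "proj_class c x = proj_class c y"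
      using U.repr_independence[of x K_units y] sub assms by (simp add: proj_class_def units_of_carrier)
  qed
  then show ?thesis by (simp add: mem)
qed

lemma scalar_Units:
  assumes "k \<noteq> 0"
  shows "scalar k \<in> Units (quat_D c)"
  unfolding Units_def using assms
  by (auto simp: one_quat_D mult_quat_D scalar_def intro!: exI[of _ "scalar (inverse k)"])

lemma proj_class_scalar_mult:
  assumes "x \<in> Units (quat_D c)" "k \<noteq> 0"
  shows "proj_class c (scalar k \<otimes>\<^bsub>quat_D c\<^esub> x) = proj_class c x"
proof -
  interpret R: ring "quat_D c" unfolding quat_D_def by (rule ring_quaternion_algebra)
  show ?thesis
    using proj_class_eq_iff[of "scalar k \<otimes>\<^bsub>quat_D c\<^esub> x" c x] scalar_Units[of k c] assms by blast
qed

lemma proj_class_one: "proj_class c (scalar 1) = \<one>\<^bsub>proj_units c\<^esub>"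
proof -
  interpret R: ring "quat_D c" unfolding quat_D_def by (rule ring_quaternion_algebra)
  interpret U: group "units_of (quat_D c)" by (rule R.units_group)
  have "subgroup K_units (units_of (quat_D c))" using K_units_normal normal.axioms(1) by blast
  then have "K_units #>\<^bsub>units_of (quat_D c)\<^esub> \<one>\<^bsub>units_of (quat_D c)\<^esub> = K_units"
    by (intro U.coset_mult_one subgroup.subset)
  then show ?thesis by (simp add: proj_class_def proj_units_def FactGroup_def units_of_one one_quat_D)
qed

section \<open>The generators as classes of \<open>1 + X\<close>\<close>

definition unit_class :: "'a::finite_field \<Rightarrow> 'a \<times> 'a \<Rightarrow> 'a poly fract quat set" where
  "unit_class c X = proj_class c (quat_embed (one_plus_power c X 1))"

lemma one_plus_power_Units: "quat_embed (one_plus_power c X n) \<in> Units (quat_D c)"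
  by (rule quat_embed_Units) (simp add: pquat_norm_one_plus_power)

lemma unit_class_carrier: "unit_class c X \<in> carrier (proj_units c)"
  unfolding unit_class_def by (rule proj_class_carrier[OF one_plus_power_Units])

lemma unit_class_pow:
  "unit_class c X [^]\<^bsub>proj_units c\<^esub> n = proj_class c (quat_embed (one_plus_power c X n))"
proof (induction n)
  case 0
  show ?case
    using proj_class_one[of c] by (simp add: one_plus_power_def scalar_def nat_pow_def)
next
  case (Suc n)
  have "unit_class c X [^]\<^bsub>proj_units c\<^esub> Suc n
      = unit_class c X [^]\<^bsub>proj_units c\<^esub> n \<otimes>\<^bsub>proj_units c\<^esub> unit_class c X"
    by (simp add: nat_pow_def)
  also have "\<dots> = proj_class c (quat_embed (one_plus_power c X (Suc n)))"
    unfolding Suc.IH unfolding unit_class_def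
    by (simp add: proj_class_mult one_plus_power_Units quat_embed_mult one_plus_power_Suc[of c X n])
  finally show ?case .
qed

text \<open>
  $(1 - X)(1 + X) = 1 - \nu(X) h$ is a scalar.
\<close>

lemma unit_class_inv:
  "inv\<^bsub>proj_units c\<^esub> (unit_class c (u, v)) = unit_class c (- u, - v)"
proof -
  interpret P: group "proj_units c" by (rule group_proj_units)
  let ?N = "[:1, - nu c (u, v):]"
  have nu: "nu c (- u, - v) = nu c (u, v)" by (simp add: nu_def)
  have "pquat_mult c (one_plus_power c (- u, - v) 1) (one_plus_power c (u, v) 1) = Quat ?N 0 0 0"
    unfolding one_plus_power_product Let_def nu
    by (simp add: nu_def power2_eq_square mult.commute one_pCons algebra_simps)
  then have "unit_class c (- u, - v) \<otimes>\<^bsub>proj_units c\<^esub> unit_class c (u, v) = proj_class c (scalar (eval_h ?N))"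
    unfolding unit_class_def
    by (simp only: proj_class_mult one_plus_power_Units quat_embed_mult quat_embed_const)
  also have "\<dots> = \<one>\<^bsub>proj_units c\<^esub>"
  proof -
    have N: "eval_h ?N \<noteq> 0" by (simp only: eval_h_eq_0_iff) simp
    have "scalar (eval_h ?N) = scalar (eval_h ?N) \<otimes>\<^bsub>quat_D c\<^esub> scalar 1"
      by (simp add: mult_quat_D scalar_def)
    then have "proj_class c (scalar (eval_h ?N)) = proj_class c (scalar 1)"
      using proj_class_scalar_mult[OF scalar_Units[of 1 c] N] by simp
    then show ?thesis by (simp only: proj_class_one)
  qed
  finally show ?thesis
    by (rule P.inv_equality) (rule unit_class_carrier)+
qed

text \<open>
  The scalar factor $k$ is only a rational function. Polynomial data are recovered from it by
  $l = k N(R)$, which is the polarised norm form of $L$ and $R$.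
\<close>

lemma quat_proportional_imp:
  fixes L R :: "'a::finite_field poly quat"
  assumes k: "quat_embed L = scalar k \<otimes>\<^bsub>quat_D c\<^esub> quat_embed R"
  obtains l where "map_quat ((*) l) R = map_quat ((*) (pquat_norm c R)) L"
    "map_quat ((*) l) L = map_quat ((*) (pquat_norm c L)) R"
    "l ^ 2 = pquat_norm c L * pquat_norm c R"
proof -
  obtain l0 l1 l2 l3 where L: "L = Quat l0 l1 l2 l3" by (cases L)
  obtain r0 r1 r2 r3 where R: "R = Quat r0 r1 r2 r3" by (cases R)
  have lr: "eval_h l0 = k * eval_h r0" "eval_h l1 = k * eval_h r1" 
      "eval_h l2 = k * eval_h r2" "eval_h l3 = k * eval_h r3"
    using k unfolding L R by (simp_all add: scalar_mult_quat_D)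
  define l where "l = l0 * r0 - [:c:] * l1 * r1 - [:0, 1:] * l2 * r2 + [:c:] * [:0, 1:] * l3 * r3"
  have l: "eval_h l = k * eval_h (pquat_norm c R)"
    by (simp only: l_def R pquat_norm.simps eval_h_add eval_h_diff eval_h_mult eval_h_power lr
        power2_eq_square algebra_simps)
  have NL: "eval_h (pquat_norm c L) = k ^ 2 * eval_h (pquat_norm c R)"
    by (simp only: L R pquat_norm.simps eval_h_add eval_h_diff eval_h_mult eval_h_power lr
        power2_eq_square algebra_simps)
  have 1: "l * r = pquat_norm c R * s" if "eval_h s = k * eval_h r" for r s
  proof -
    have "eval_h (l * r) = eval_h (pquat_norm c R * s)" unfolding eval_h_mult l that by (simp only: mult_ac)
    then show ?thesis by (simp only: eval_h_eq_iff)
  qed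
  have 2: "l * s = pquat_norm c L * r" if "eval_h s = k * eval_h r" for r s
  proof -
    have "eval_h (l * s) = eval_h (pquat_norm c L * r)" 
      unfolding eval_h_mult l NL that by (simp only: power2_eq_square mult_ac)
    then show ?thesis by (simp only: eval_h_eq_iff)
  qed
  have "eval_h (l ^ 2) = eval_h (pquat_norm c L * pquat_norm c R)"
    unfolding eval_h_mult eval_h_power l NL by (simp only: power2_eq_square mult_ac)
  then have 3: "l ^ 2 = pquat_norm c L * pquat_norm c R" by (simp only: eval_h_eq_iff)
  show ?thesis
    by (rule that[of l, OF _ _ 3]; unfold L R quat.map quat.inject)
       (use 1 2 lr in \<open>simp_all only: L R simp_thms\<close>)
qed

lemma unit_class_products_eq_iff:
  fixes c :: "'a::finite_field"
  assumes nz: "\<alpha> \<noteq> 0" "\<beta> \<noteq> 0" "\<alpha> \<noteq> \<beta>" "(2::'a) \<noteq> 0"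
    and nu: "nu c X = \<alpha>" "nu c Y = \<beta>" "nu c X' = \<alpha>" "nu c Y' = \<beta>"
  shows "unit_class c X [^]\<^bsub>proj_units c\<^esub> m \<otimes>\<^bsub>proj_units c\<^esub> unit_class c Y [^]\<^bsub>proj_units c\<^esub> n
      = unit_class c Y' [^]\<^bsub>proj_units c\<^esub> n' \<otimes>\<^bsub>proj_units c\<^esub> unit_class c X' [^]\<^bsub>proj_units c\<^esub> m'
    \<longleftrightarrow> m = m' \<and> n = n' \<and>
      pquat_mult c (one_plus_power c X m) (one_plus_power c Y n)
      = pquat_mult c (one_plus_power c Y' n') (one_plus_power c X' m')"
proof -
  define L where "L = pquat_mult c (one_plus_power c X m) (one_plus_power c Y n)"
  define R where "R = pquat_mult c (one_plus_power c Y' n') (one_plus_power c X' m')"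
  have NL: "pquat_norm c L = [:1, -\<alpha>:] ^ m * [:1, -\<beta>:] ^ n"
    by (simp only: L_def pquat_norm_mult pquat_norm_one_plus_power nu)
  have NR: "pquat_norm c R = [:1, -\<alpha>:] ^ m' * [:1, -\<beta>:] ^ n'"
    by (simp only: R_def pquat_norm_mult pquat_norm_one_plus_power nu mult.commute)
  have U: "quat_embed L \<in> Units (quat_D c)" "quat_embed R \<in> Units (quat_D c)"
    by (rule quat_embed_Units, simp add: NL NR)+
  have re: "poly (pquat_re (pquat_mult c (one_plus_power c A i) (one_plus_power c B j))) 0 = 1" for A B i j
    by (cases A; cases B)
       (simp add: one_plus_power_product Let_def coeff_mult_0 coeff_parts poly_0_coeff_0 del: pquat_mult.simps)
  have "m = m' \<and> n = n' \<and> L = R" if emb: "quat_embed L = scalar k \<otimes>\<^bsub>quat_D c\<^esub> quat_embed R" for k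
  proof -
    have r: "\<alpha> * inverse \<alpha> = 1" "\<beta> * inverse \<alpha> \<noteq> 1" "\<beta> * inverse \<beta> = 1" "\<alpha> * inverse \<beta> \<noteq> 1"
      using nz by (auto simp: field_simps)
    obtain l where l: "map_quat ((*) l) R = map_quat ((*) (pquat_norm c R)) L"
      "map_quat ((*) l) L = map_quat ((*) (pquat_norm c L)) R"
      "l ^ 2 = pquat_norm c L * pquat_norm c R"
      using quat_proportional_imp[OF emb] .
    show ?thesis
    proof (rule power_products_rigid[OF l NL NR nz])
      show "\<exists>f\<in>set_quat L. poly f (inverse \<alpha>) \<noteq> 0" if "m > 0"
        unfolding L_def by (rule one_plus_power_product_nonzero(1)) (use r nz that in \<open>simp_all add: nu\<close>)
      show "\<exists>f\<in>set_quat L. poly f (inverse \<beta>) \<noteq> 0" if "n > 0"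
        unfolding L_def by (rule one_plus_power_product_nonzero(2)) (use r nz that in \<open>simp_all add: nu\<close>)
      show "\<exists>f\<in>set_quat R. poly f (inverse \<alpha>) \<noteq> 0" if "m' > 0"
        unfolding R_def by (rule one_plus_power_product_nonzero(2)) (use r nz that in \<open>simp_all add: nu\<close>)
      show "\<exists>f\<in>set_quat R. poly f (inverse \<beta>) \<noteq> 0" if "n' > 0"
        unfolding R_def by (rule one_plus_power_product_nonzero(1)) (use r nz that in \<open>simp_all add: nu\<close>)
    qed (simp_all only: L_def R_def re)
  qed
  moreover have "scalar 1 \<otimes>\<^bsub>quat_D c\<^esub> quat_embed R = quat_embed R"
    by (cases "quat_embed R") (simp add: scalar_mult_quat_D)
  ultimately have "proj_class c (quat_embed L) = proj_class c (quat_embed R)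
      \<longleftrightarrow> m = m' \<and> n = n' \<and> L = R"
    unfolding proj_class_eq_iff[OF U] by (metis zero_neq_one)
  then show ?thesis
    by (simp add: unit_class_pow proj_class_mult one_plus_power_Units quat_embed_mult L_def R_def)
qed

text \<open>
  The $q$-th power map is the conjugation of $\mathbb{F}_q[Z]$. For $x \neq 0$ one has
  $x + yZ = x (1 + rZ)$ with $(rZ)^2 = c r^2$, so the formula for the $p^m$-th power of a binomial
  applies, and $c^{(q-1)/2} = -1$ gives the sign.
\<close>

lemma nat_pow_quat_F_q_Z:
  fixes c x y :: "'a::finite_field"
  assumes card: "CARD('a) = p ^ m" "prime p" "odd p" and c: "c \<noteq> 0" "\<not> (\<exists>x. c = x ^ 2)"
  shows "Quat (const_K x) (const_K y) 0 0 [^]\<^bsub>quat_D c\<^esub> CARD('a) = Quat (const_K x) (- const_K y) 0 0"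
proof -
  have char: "p = CHAR('a)" using CHAR_of_card_prime_power[OF card(2,1)] by simp
  obtain e where e: "CARD('a) = 2 * e + 1" using card(1,3) by (metis even_power oddE)
  have ce: "c ^ e = -1" by (rule nonsquare_power_half[OF e c])
  have q: "z ^ CARD('a) = z" for z :: 'a by (rule finite_field_power_card_eq_same)
  have fermat: "z ^ (2 * e) = 1" if "z \<noteq> 0" for z :: 'a
    using q[of z] that unfolding e by simp
  have pow_Suc: "\<xi> [^]\<^bsub>quat_D c\<^esub> Suc n = \<xi> [^]\<^bsub>quat_D c\<^esub> n \<otimes>\<^bsub>quat_D c\<^esub> \<xi>" for \<xi> n
    by (simp add: nat_pow_def)
  have pow_0: "\<xi> [^]\<^bsub>quat_D c\<^esub> (0::nat) = scalar 1" for \<xi>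
    by (simp add: nat_pow_def one_quat_D)
  show ?thesis
  proof (cases "x = 0")
    case True
    have "Quat 0 (const_K y) 0 0 [^]\<^bsub>quat_D c\<^esub> (2 * n + 1) = Quat 0 (const_K (c ^ n * y ^ (2 * n + 1))) 0 0" for n
      by (induction n) (simp_all add: pow_Suc pow_0 one_quat_D mult_quat_D scalar_def algebra_simps)
    moreover have "y ^ (2 * e + 1) = y" using q[of y] unfolding e .
    ultimately show ?thesis using True by (simp only: e ce const_K_simps) simp
  next
    case False
    define r where "r = y / x"
    define \<alpha> where "\<alpha> = c * r ^ 2"
    let ?E = "\<lambda>n. poly (even_part \<alpha> n) 1" and ?O = "\<lambda>n. poly (odd_part \<alpha> n) 1"
    have y: "y = r * x" using False by (simp add: r_def)
    have pow: "Quat (const_K x) (const_K y) 0 0 [^]\<^bsub>quat_D c\<^esub> n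
        = Quat (const_K (x ^ n * ?E n)) (const_K (x ^ n * r * ?O n)) 0 0" for n
      by (induction n) (simp_all add: pow_Suc pow_0 one_quat_D mult_quat_D scalar_def y \<alpha>_def power2_eq_square algebra_simps)
    moreover have "?E CARD('a) = 1" "?O CARD('a) = \<alpha> ^ e"
      using parts_char_power[OF char card(3), of \<alpha> m] e unfolding card(1)[symmetric] by simp_all
    moreover have "r * \<alpha> ^ e = - r"
      using fermat[of r] ce by (cases "r = 0") (simp_all add: \<alpha>_def power_mult_distrib flip: power_mult)
    ultimately have "x ^ CARD('a) * ?E CARD('a) = x" "x ^ CARD('a) * r * ?O CARD('a) = - y"
      by (simp_all only: q y mult.assoc mult_1_right) (simp add: mult.commute)
    with pow[of "CARD('a)"] show ?thesis by (simp only: const_K_simps)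
  qed
qed

text \<open>
  As $FZ = -ZF$, the representative $c t + (x + yZ) FZ$ equals $ct - (c y + x Z) F$, that is, $ct$ times
  $1 + (u + vZ) F / t$ with $u = -y$ and $v = -x/c$.
\<close>

lemma gen_class_eq_unit_class:
  fixes c r :: "'a::finite_field"
  assumes card: "CARD('a) = p ^ m" "prime p" "odd p" and c: "c \<noteq> 0" "\<not> (\<exists>x. c = x ^ 2)"
    and g: "g \<in> gen_class c ` norm_fibre c r"
  obtains X where "nu c X = - r / c" "g = unit_class c X"
proof -
  obtain \<xi> where \<xi>: "\<xi> \<in> norm_fibre c r" "g = gen_class c \<xi>" using g by blast
  then obtain x y where xy: "\<xi> = Quat (const_K x) (const_K y) 0 0"
    by (auto simp: norm_fibre_def Fq_Z_def mult_quat_D scalar_def quat_Z_def quat_D_def quaternion_algebra_def)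
  have "\<xi> \<otimes>\<^bsub>quat_D c\<^esub> quat_conj c \<xi> = scalar (const_K r)" using \<xi> by (simp add: norm_fibre_def)
  then have "const_K (x ^ 2 - c * y ^ 2) = const_K r"
    unfolding xy quat_conj_def nat_pow_quat_F_q_Z[OF card c]
    by (simp add: mult_quat_D scalar_def power2_eq_square algebra_simps)
  then have r: "x ^ 2 - c * y ^ 2 = r" by (simp only: const_K_eq_iff)
  let ?X = "(- y, - x / c)"
  let ?g = "scalar (const_K c * t_K) \<oplus>\<^bsub>quat_D c\<^esub> \<xi> \<otimes>\<^bsub>quat_D c\<^esub> quat_F \<otimes>\<^bsub>quat_D c\<^esub> quat_Z"
  have cx: "const_K c * const_K (x / c) = const_K x" using c by (simp flip: const_K_simps(4))
  have eq: "?g = scalar (const_K c * t_K) \<otimes>\<^bsub>quat_D c\<^esub> quat_embed (one_plus_power c ?X 1)"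
    using cx by (simp add: xy mult_quat_D scalar_def quat_F_def quat_Z_def quat_D_def quaternion_algebra_def one_plus_power_def field_simps)
  show ?thesis
  proof (rule that)
    show "nu c ?X = - r / c" using c by (simp add: nu_def r[symmetric] field_simps power2_eq_square)
    show "g = unit_class c ?X"
      unfolding \<xi>(2) gen_class_def unit_class_def eq
      by (rule proj_class_scalar_mult[OF one_plus_power_Units]) (use c in simp)
  qed
qed

section \<open>The relations of the given shape\<close>

text \<open>
  The hypothesis \<open>base\<close> is the relation with all exponents equal to $1$. It makes the first two coordinates
  agree for all exponents, and turns the difference of the last two into a multiple of the nonzero vector
  $(u_1 - u_3, v_1 - v_3)$.
\<close>

lemma product_coords_eq_iff_char_power:
  fixes c \<alpha> \<beta> :: "'a::field_prime_char"
  assumes p: "p = CHAR('a)" "odd p"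
    and nz: "\<alpha> \<noteq> 0" "\<beta> \<noteq> 0" "\<alpha> \<noteq> \<beta>"
    and nu: "nu c (u1, v1) = \<alpha>" "nu c (u2, v2) = \<beta>" "nu c (u3, v3) = \<alpha>" "nu c (u4, v4) = \<beta>"
    and base: "pquat_mult c (one_plus_power c (u1, v1) 1) (one_plus_power c (u2, v2) 1)
      = pquat_mult c (one_plus_power c (u4, v4) 1) (one_plus_power c (u3, v3) 1)"
    and ne: "(u1, v1) \<noteq> (u3, v3)"
  shows "pquat_mult c (one_plus_power c (u1, v1) m) (one_plus_power c (u2, v2) n)
      = pquat_mult c (one_plus_power c (u4, v4) n) (one_plus_power c (u3, v3) m)
    \<longleftrightarrow> m = 0 \<and> n = 0 \<or> (\<exists>i. m = p ^ i \<and> n = p ^ i \<and> \<alpha> ^ ((p ^ i - 1) div 2) = \<beta> ^ ((p ^ i - 1) div 2))"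
proof -
  have two: "(2::'a) \<noteq> 0" using two_nonzero_of_odd_char p by blast
  have b: "u1 * u2 - c * v1 * v2 = u4 * u3 - c * v4 * v3" "v1 * u2 - u1 * v2 = v4 * u3 - u4 * v3"
      "u1 - u3 = - (u2 - u4)" "v1 - v3 = - (v2 - v4)"
    using base unfolding one_plus_power_product Let_def
    by (simp_all add: algebra_simps)
  let ?f = "even_part \<alpha> m" and ?g = "odd_part \<alpha> m" and ?f' = "even_part \<beta> n" and ?g' = "odd_part \<beta> n"
  have comm: "?g' * ?f = ?f * ?g'" "?f' * ?g = ?g * ?f'" "?f' * ?f = ?f * ?f'" "?g' * ?g = ?g * ?g'"
    by (rule mult.commute)+
  have coord: "smult s2 A + smult s1 B = smult s3 B + smult s4 A \<longleftrightarrow> smult (s1 - s3) (B - A) = 0"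
    if "s1 - s3 = - (s2 - s4)" for s1 s2 s3 s4 and A B :: "'a poly"
  proof -
    have "s2 - s4 = - (s1 - s3)" using that by simp
    then have "smult (s1 - s3) (B - A) = smult (s1 - s3) B + smult (s2 - s4) A"
      by (simp only: smult_diff_right smult_minus_left add_uminus_conv_diff)
    also have "\<dots> = smult s2 A + smult s1 B - (smult s3 B + smult s4 A)"
      by (simp add: smult_diff_left)
    finally show ?thesis by simp
  qed
  have "pquat_mult c (one_plus_power c (u1, v1) m) (one_plus_power c (u2, v2) n)
      = pquat_mult c (one_plus_power c (u4, v4) n) (one_plus_power c (u3, v3) m)
    \<longleftrightarrow> smult u2 (?f * ?g') + smult u1 (?g * ?f') = smult u3 (?g * ?f') + smult u4 (?f * ?g')
      \<and> smult v2 (?f * ?g') + smult v1 (?g * ?f') = smult v3 (?g * ?f') + smult v4 (?f * ?g')"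
    unfolding one_plus_power_product Let_def nu quat.inject b(1,2) comm by simp
  also have "\<dots> \<longleftrightarrow> smult (u1 - u3) (?g * ?f' - ?f * ?g') = 0 \<and> smult (v1 - v3) (?g * ?f' - ?f * ?g') = 0"
    unfolding coord[OF b(3)] coord[OF b(4)] ..
  also have "\<dots> \<longleftrightarrow> ?f * ?g' = ?g * ?f'"
    using ne unfolding smult_eq_0_iff right_minus_eq by auto
  also have "\<dots> \<longleftrightarrow> ?f = ?f' \<and> ?g = ?g'"
    using parts_proportional_imp_eq[OF nz(1,2) two, of m n] by auto
  also have "\<dots> \<longleftrightarrow> m = 0 \<and> n = 0 \<or> (\<exists>i. m = p ^ i \<and> n = p ^ i \<and> \<alpha> ^ ((p ^ i - 1) div 2) = \<beta> ^ ((p ^ i - 1) div 2))"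
  proof
    assume fg: "?f = ?f' \<and> ?g = ?g'"
    have deg: "i = 0" if "even_part \<gamma> i = 1" "odd_part \<gamma> i = 0" "\<gamma> \<noteq> 0" for \<gamma> :: 'a and i
    proof -
      have "[:1, - \<gamma>:] ^ i = 1" using norm_parts[of \<gamma> i] that by simp
      then have "degree ([:1, - \<gamma>:] ^ i) = 0" by simp
      then show ?thesis using that(3) by (simp add: degree_power_eq)
    qed
    show "m = 0 \<and> n = 0 \<or> (\<exists>i. m = p ^ i \<and> n = p ^ i \<and> \<alpha> ^ ((p ^ i - 1) div 2) = \<beta> ^ ((p ^ i - 1) div 2))"
    proof (cases "m = 0 \<or> n = 0")
      case True
      then show ?thesis using fg deg[of \<beta> n] deg[of \<alpha> m] nz by auto
    next
      case False
      then obtain i where i: "m = p ^ i" "n = p ^ i"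
        using parts_eq_imp_char_power[OF p nz, of m n 1] fg by auto
      let ?e = "(p ^ i - 1) div 2"
      have "[:0, \<gamma>:] ^ ?e = monom (\<gamma> ^ ?e) ?e" for \<gamma> :: 'a
        by (simp add: monom_altdef flip: smult_power)
      then have "coeff ([:0, \<gamma>:] ^ ?e) ?e = \<gamma> ^ ?e" for \<gamma> :: 'a by simp
      moreover have "[:0, \<alpha>:] ^ ?e = [:0, \<beta>:] ^ ?e"
        using fg unfolding i parts_char_power[OF p] by simp
      ultimately have "\<alpha> ^ ?e = \<beta> ^ ?e" by metis
      then show ?thesis using i by blast
    qed
  next
    have pow: "[:0, \<gamma>:] ^ e = smult (\<gamma> ^ e) ([:0, 1:] ^ e)" for \<gamma> :: 'a and e
      by (simp flip: smult_power)
    assume "m = 0 \<and> n = 0 \<or> (\<exists>i. m = p ^ i \<and> n = p ^ i \<and> \<alpha> ^ ((p ^ i - 1) div 2) = \<beta> ^ ((p ^ i - 1) div 2))"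
    then consider "m = 0" "n = 0" | i where "m = p ^ i" "n = p ^ i" "\<alpha> ^ ((p ^ i - 1) div 2) = \<beta> ^ ((p ^ i - 1) div 2)"
      by blast
    then show "?f = ?f' \<and> ?g = ?g'"
    proof cases
      case (2 i)
      show ?thesis unfolding 2(1,2) parts_char_power[OF p] pow[of \<alpha>] pow[of \<beta>] 2(3) by simp
    qed simp
  qed
  finally show ?thesis .
qed

lemma (in group) word_value_append:
  assumes "set u \<subseteq> carrier G" "set w \<subseteq> carrier G"
  shows "word_value G (u @ w) = word_value G u \<otimes> word_value G w"
proof -
  have closed: "word_value G w \<in> carrier G" if "set w \<subseteq> carrier G" for w
    using that by (induction w) (auto simp: word_value_def)
  show ?thesis
    using assms closed by (induction u) (auto simp: word_value_def m_assoc)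
qed

lemma (in group) word_value_replicate:
  assumes "x \<in> carrier G"
  shows "word_value G (replicate n x) = x [^] n"
  using assms by (induction n) (simp_all only: word_value_def replicate.simps foldr.simps comp_def id_apply nat_pow_0 nat_pow_Suc2)

lemma (in group) four_letter_relation_iff:
  assumes "a \<in> carrier G" "b \<in> carrier G" "c \<in> carrier G" "d \<in> carrier G"
  shows "word_value G (replicate n1 a @ replicate n2 b @ replicate n3 c @ replicate n4 d) = \<one>
    \<longleftrightarrow> a [^] n1 \<otimes> b [^] n2 = inv d [^] n4 \<otimes> inv c [^] n3"
proof -
  have s: "set (replicate n x) \<subseteq> carrier G" if "x \<in> carrier G" for x n
    using that by (auto simp: set_replicate_conv_if)
  have inv: "x \<otimes> y = \<one> \<longleftrightarrow> x = inv y" if "x \<in> carrier G" "y \<in> carrier G" for x y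
    using that by (metis inv_equality l_inv)
  have "word_value G (replicate n1 a @ replicate n2 b @ replicate n3 c @ replicate n4 d)
      = (a [^] n1 \<otimes> b [^] n2) \<otimes> (c [^] n3 \<otimes> d [^] n4)"
    by (simp add: word_value_append word_value_replicate s assms m_assoc del: set_replicate)
  also have "\<dots> = \<one> \<longleftrightarrow> a [^] n1 \<otimes> b [^] n2 = inv (c [^] n3 \<otimes> d [^] n4)"
    by (simp add: inv assms)
  also have "inv (c [^] n3 \<otimes> d [^] n4) = inv d [^] n4 \<otimes> inv c [^] n3"
    using assms by (simp add: inv_mult_group nat_pow_inv)
  finally show ?thesis .
qed

theorem theorem5:
  fixes p q m :: nat and \<tau> c0 :: "'a :: finite_field"
    and a b c d :: "'a poly fract quat set"
  assumes "prime p" "odd p" "m \<ge> 1" "q = p ^ m" "CARD('a) = q"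
    and "\<tau> \<noteq> 0" "\<tau> \<noteq> 1"
    and "c0 \<noteq> 0" "\<not> (\<exists>x. c0 = x ^ 2)"
    and "a \<in> gens_A c0" "c \<in> gens_A c0" "b \<in> gens_B c0 \<tau>" "d \<in> gens_B c0 \<tau>"
    and "a \<otimes>\<^bsub>Gamma c0 \<tau>\<^esub> b \<otimes>\<^bsub>Gamma c0 \<tau>\<^esub> c \<otimes>\<^bsub>Gamma c0 \<tau>\<^esub> d = \<one>\<^bsub>Gamma c0 \<tau>\<^esub>"
    and "a \<otimes>\<^bsub>Gamma c0 \<tau>\<^esub> b \<noteq> b \<otimes>\<^bsub>Gamma c0 \<tau>\<^esub> a"
  shows "{(n1, n2, n3, n4).
            replicate n1 a @ replicate n2 b @ replicate n3 c @ replicate n4 d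
              \<in> word_problem (Gamma c0 \<tau>) (gens_A c0 \<union> gens_B c0 \<tau>)} =
         {(0, 0, 0, 0)} \<union>
         {(p ^ (k_exp p \<tau> * n), p ^ (k_exp p \<tau> * n), p ^ (k_exp p \<tau> * n), p ^ (k_exp p \<tau> * n))
          | n :: nat. True}"
proof -
  interpret P: group "proj_units c0" by (rule group_proj_units)
  define \<rho> where "\<rho> = \<tau> / (\<tau> - 1)"
  have card: "CARD('a) = p ^ m" "prime p" "odd p" using assms(1-5) by simp_all
  have char: "p = CHAR('a)" using CHAR_of_card_prime_power[OF card(2,1)] by simp
  have two: "(2::'a) \<noteq> 0" using two_nonzero_of_odd_char char card(3) by blast
  have \<rho>: "\<rho> \<noteq> 0" "1 \<noteq> \<rho>" using assms(6,7) by (auto simp: \<rho>_def field_simps)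
  have \<rho>_nu: "- (c0 * \<tau> / (1 - \<tau>)) / c0 = \<rho>" 
    using assms(7,8) by (simp add: \<rho>_def field_simps)
  note gen = gen_class_eq_unit_class[OF card assms(8,9)]
  obtain X1 where X1: "nu c0 X1 = 1" "a = unit_class c0 X1"
    using gen[of a "- c0"] assms(8,10) unfolding gens_A_def by auto
  obtain X3 where X3: "nu c0 X3 = 1" "c = unit_class c0 X3"
    using gen[of c "- c0"] assms(8,11) unfolding gens_A_def by auto
  obtain X2 where X2: "nu c0 X2 = \<rho>" "b = unit_class c0 X2"
    using gen[of b "c0 * \<tau> / (1 - \<tau>)"] assms(12) unfolding gens_B_def \<rho>_nu by auto
  obtain X4 where X4: "nu c0 X4 = \<rho>" "d = unit_class c0 X4"
    using gen[of d "c0 * \<tau> / (1 - \<tau>)"] assms(13) unfolding gens_B_def \<rho>_nu by auto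
  obtain u1 v1 u2 v2 u3 v3 u4 v4 where uv: "X1 = (u1, v1)" "X2 = (u2, v2)" "X3 = (u3, v3)" "X4 = (u4, v4)"
    by (cases X1; cases X2; cases X3; cases X4)
  note carr = unit_class_carrier[of c0 X1, folded X1(2)] unit_class_carrier[of c0 X2, folded X2(2)]
    unit_class_carrier[of c0 X3, folded X3(2)] unit_class_carrier[of c0 X4, folded X4(2)]
  let ?L = "\<lambda>i j. pquat_mult c0 (one_plus_power c0 (u1, v1) i) (one_plus_power c0 (u2, v2) j)"
  let ?R = "\<lambda>i j. pquat_mult c0 (one_plus_power c0 (- u4, - v4) j) (one_plus_power c0 (- u3, - v3) i)"
  \<comment> \<open>The signs come from solving \<open>a b c d = e\<close> for \<open>a b\<close>.\<close>
  have nu: "nu c0 (u1, v1) = 1" "nu c0 (u2, v2) = \<rho>" "nu c0 (- u3, - v3) = 1" "nu c0 (- u4, - v4) = \<rho>"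
    using X1 X2 X3 X4 by (simp_all add: uv nu_def)
  have rel: "word_value (proj_units c0) (replicate n1 a @ replicate n2 b @ replicate n3 c @ replicate n4 d) = \<one>\<^bsub>proj_units c0\<^esub>
      \<longleftrightarrow> n1 = n3 \<and> n2 = n4 \<and> ?L n1 n2 = ?R n3 n4" for n1 n2 n3 n4
    unfolding P.four_letter_relation_iff[OF carr] unfolding X1(2) X2(2) X3(2) X4(2) uv unit_class_inv
    by (rule unit_class_products_eq_iff[OF one_neq_zero \<rho>(1) \<rho>(2) two nu])
  have mult: "x \<otimes>\<^bsub>Gamma c0 \<tau>\<^esub> y = x \<otimes>\<^bsub>proj_units c0\<^esub> y" for x y by (simp add: Gamma_def)
  have one: "\<one>\<^bsub>Gamma c0 \<tau>\<^esub> = \<one>\<^bsub>proj_units c0\<^esub>" by (simp add: Gamma_def)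
  have base: "?L 1 1 = ?R 1 1"
  proof -
    have "word_value (proj_units c0) (replicate 1 a @ replicate 1 b @ replicate 1 c @ replicate 1 d)
        = a \<otimes>\<^bsub>proj_units c0\<^esub> b \<otimes>\<^bsub>proj_units c0\<^esub> c \<otimes>\<^bsub>proj_units c0\<^esub> d"
      using carr by (simp add: word_value_def P.m_assoc)
    also have "\<dots> = \<one>\<^bsub>proj_units c0\<^esub>" using assms(14) unfolding mult one .
    finally show ?thesis unfolding rel by blast
  qed
  \<comment> \<open>Otherwise \<open>c\<close> is the inverse of \<open>a\<close>, then \<open>d\<close> that of \<open>b\<close>, and the relation is a commutation.\<close>
  have ne: "(u1, v1) \<noteq> (- u3, - v3)"
  proof
    assume eq: "(u1, v1) = (- u3, - v3)"
    then have "(u2, v2) = (- u4, - v4)"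
      using base unfolding one_plus_power_product Let_def by simp
    then have "?L 1 1 = pquat_mult c0 (one_plus_power c0 (u2, v2) 1) (one_plus_power c0 (u1, v1) 1)"
      using base eq by simp
    then have "a \<otimes>\<^bsub>proj_units c0\<^esub> b = b \<otimes>\<^bsub>proj_units c0\<^esub> a"
      unfolding X1(2) X2(2) uv unit_class_def
      by (simp add: proj_class_mult one_plus_power_Units quat_embed_mult)
    then show False using assms(15) by (simp add: mult)
  qed
  have "replicate n1 a @ replicate n2 b @ replicate n3 c @ replicate n4 d
      \<in> word_problem (Gamma c0 \<tau>) (gens_A c0 \<union> gens_B c0 \<tau>)
    \<longleftrightarrow> n1 = n3 \<and> n2 = n4 \<and> (n1 = 0 \<and> n2 = 0 \<or> (\<exists>i. n1 = p ^ i \<and> n2 = p ^ i \<and> k_exp p \<tau> dvd i))" for n1 n2 n3 n4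
  proof -
    have lists: "replicate n1 a @ replicate n2 b @ replicate n3 c @ replicate n4 d \<in> lists (gens_A c0 \<union> gens_B c0 \<tau>)"
      using assms(10-13) by auto
    have eval_word: "word_value (Gamma c0 \<tau>) w = word_value (proj_units c0) w" for w
      by (simp add: word_value_def Gamma_def)
    have coords: "?L i j = ?R i j \<longleftrightarrow> i = 0 \<and> j = 0 \<or> (\<exists>l. i = p ^ l \<and> j = p ^ l \<and> k_exp p \<tau> dvd l)" for i j
      unfolding product_coords_eq_iff_char_power[OF char card(3) one_neq_zero \<rho> nu base ne, of i j]
        power_half_eq_1_iff_k_exp_dvd[OF card(2,3,1) assms(6,7), symmetric]
      unfolding \<rho>_def[symmetric] power_one eq_commute[of "1::'a"] ..
    show ?thesis
      unfolding word_problem_def mem_Collect_eq eval_word one rel coords[symmetric]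
      using lists by (intro iffI conjI; elim conjE) simp_all
  qed
  note words = this
  have "(n1 = n3 \<and> n2 = n4 \<and> (n1 = 0 \<and> n2 = 0 \<or> (\<exists>i. n1 = p ^ i \<and> n2 = p ^ i \<and> k dvd i)))
    \<longleftrightarrow> (n1, n2, n3, n4) \<in> {(0, 0, 0, 0)} \<union> {(p ^ (k * n), p ^ (k * n), p ^ (k * n), p ^ (k * n)) | n. True}"
    for n1 n2 n3 n4 k
    unfolding dvd_def by blast
  note tuples = this
  show ?thesis
  proof (rule Set.set_eqI)
    fix x :: "nat \<times> nat \<times> nat \<times> nat"
    obtain n1 n2 n3 n4 where x: "x = (n1, n2, n3, n4)" by (cases x)
    show "x \<in> {(n1, n2, n3, n4). replicate n1 a @ replicate n2 b @ replicate n3 c @ replicate n4 d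
            \<in> word_problem (Gamma c0 \<tau>) (gens_A c0 \<union> gens_B c0 \<tau>)}
       \<longleftrightarrow> x \<in> {(0, 0, 0, 0)} \<union>
         {(p ^ (k_exp p \<tau> * n), p ^ (k_exp p \<tau> * n), p ^ (k_exp p \<tau> * n), p ^ (k_exp p \<tau> * n)) | n :: nat. True}" unfolding x tuples[symmetric] words[symmetric] by simp
  qed
qed

end
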